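(* Under the density hypothesis on $G$ and the integrability condition $\mathbb E[\sup_{t\in[0,T]}|L_t|+|\xi|]<\infty$ on the payoff, for every $t\in[0,T]$, $$V^G_t:=\operatorname*{ess\,sup}_{\tau'\in\mathcal T_{t,T}(\mathbb G)}\mathbb E\left[R(\tau')\,|\,\mathcal G_t\right]=\frac{1}{\alpha_t(G)}\left(\operatorname*{ess\,sup}_{\tau(\cdot)\in\mathcal T_{t,T}(\widehat{\mathbb F})}\widehat{\mathbb E}\left[R(\cdot,\tau(\cdot))\,|\,\widehat{\mathcal F}_t\right]\right)_{G}\qquad \mathbb P\text{-a.s.}$$
   Context: Let $T>0$ and let $(\Omega,\mathcal F,\mathbb F=(\mathcal F_t)_{t\in[0,T]},\mathbb P)$ be a filtered probability space with $\mathbb F$ right-continuous and complete and $\mathcal F_0$ trivial. Let $G:\Omega\to\mathbb R$ be a random variable with law $P^G$, and let $\mathbb G=(\mathcal G_t)_{t\in[0,T]}$, $\mathcal G_t=\mathcal F_t\vee\sigma(G)$. Density hypothesis: for every $t\in[0,T]$ the regular conditional law $P^G_t(\omega,\cdot)$ of $G$ given $\mathcal F_t$ is equivalent to $P^G$ for $\mathbb P$-a.e. $\omega$. For each $t\in[0,T]$, $\alpha_t(u)(\omega)=\frac{dP^G_t(\omega,\cdot)}{dP^G}(u)$ denotes an $\mathcal F\otimes\mathcal B(\mathbb R)$-measurable, strictly positive version of the density (which exists by a result of Jacod); for each $u\in\mathbb R$, $(\alpha_t(u))_{t\in[0,T]}$ is an $\mathbb F$-martingale. Product space: $\widehat\Omega=\Omega\times\mathbb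 R$, $\widehat{\mathcal F}=\mathcal F\otimes\mathcal B(\mathbb R)$, $\widehat{\mathcal F}_t=\bigcap_{s>t}(\mathcal F_s\otimes\mathcal B(\mathbb R))$, $\widehat{\mathbb F}=(\widehat{\mathcal F}_t)_{t\in[0,T]}$, $\widehat{\mathbb P}=\mathbb P\otimes P^G$, with expectation $\widehat{\mathbb E}$. It is assumed (without loss of generality) that $(\widehat\Omega,\widehat{\mathcal F},\widehat{\mathbb P})$ is complete and that $\widehat{\mathcal F}_0$ contains all $\widehat{\mathbb P}$-null sets of $\widehat{\mathcal F}$. For a function $X$ on $\widehat\Omega$, $X(u)=X(\cdot,u)$, and $X_G$ or $X(G)$ denotes the random variable $\omega\mapsto X(\omega,G(\omega))$. Payoff: $R(t)=L_t1_{[0,T)}(t)+\xi1_{\{T\}}(t)$, where $L$ is a real-valued càdlàg $\mathbb F$-adapted process, $\xi$ is an $\mathcal F_T$-measurable random variable, and $0\le L_T\le\xi<\infty$. The payoff on the product space is $R(u,t)=L_t\alpha_t(u)1_{[0,T)}(t)+\xi\alpha_T(u)1_{\{T\}}(t)$. $R(\cdot,\tau(\cdot))$ is the map $(\omega,u)\mapsto R(u,\tau(\omega,u))(\omega)$. For a filtration $\mathbb H$, $\mathcal T_{t,T}(\mathbb H)$ is the set of $\mathbb H$-stopping times with values in $[t,T]$.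
   Formalization: The density α_t is taken F_T⊗B(R)-measurable (not just F⊗B(R)) with càdlàg paths in t, and the essential supremum on the product space is inserted at G through an F_T⊗B(R)-measurable version, since otherwise values at u=G are not determined. *)

theory Defs
  imports "HOL-Probability.Probability"
begin

section \<open>The filtered probability space\<close>

locale filtered_prob_space = prob_space M + complete_measure M
  for M :: "'a measure" +
  fixes F :: "real \<Rightarrow> 'a measure" and T :: real
  assumes T_pos: "0 < T"
    and subalgebra_F: "t \<in> {0..T} \<Longrightarrow> subalgebra M (F t)"
    and mono_F: "\<lbrakk>0 \<le> s; s \<le> t; t \<le> T\<rbrakk> \<Longrightarrow> sets (F s) \<subseteq> sets (F t)"
    and right_continuous_F: "t \<in> {0..<T} \<Longrightarrow> sets (F t) = (\<Inter>s\<in>{t<..T}. sets (F s))"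
    and null_sets_F: "null_sets M \<subseteq> sets (F 0)"
    and trivial_F0: "A \<in> sets (F 0) \<Longrightarrow> prob A = 0 \<or> prob A = 1"

definition cadlag_on :: "real \<Rightarrow> (real \<Rightarrow> real) \<Rightarrow> bool" where
  "cadlag_on T f \<longleftrightarrow>
     (\<forall>t\<in>{0..<T}. (f \<longlongrightarrow> f t) (at_right t)) \<and>
     (\<forall>t\<in>{0<..T}. \<exists>l. (f \<longlongrightarrow> l) (at_left t))"

definition martingale_on ::
    "'a measure \<Rightarrow> (real \<Rightarrow> 'a measure) \<Rightarrow> real \<Rightarrow> (real \<Rightarrow> 'a \<Rightarrow> real) \<Rightarrow> bool" where
  "martingale_on M F T X \<longleftrightarrow>
     (\<forall>t\<in>{0..T}. X t \<in> borel_measurable (F t) \<and> integrable M (X t)) \<and>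
     (\<forall>s\<in>{0..T}. \<forall>t\<in>{s..T}. AE \<omega> in M. real_cond_exp M (F s) (X t) \<omega> = X s \<omega>)"

text \<open>
  The index set of a filtration is \<open>[0,T]\<close>; clamping the index gives a filtration over all
  reals for the library's notion of stopping time, and the conditions at indices outside
  \<open>[0,T]\<close> hold automatically for times with values in \<open>[t,T]\<close>.
\<close>

definition stopping_times ::
    "'b set \<Rightarrow> (real \<Rightarrow> 'b measure) \<Rightarrow> real \<Rightarrow> real \<Rightarrow> ('b \<Rightarrow> real) set" where
  "stopping_times \<Omega> H T t =
     {\<tau>. (\<forall>\<omega>\<in>\<Omega>. \<tau> \<omega> \<in> {t..T}) \<and> stopping_time (\<lambda>s. H (max 0 (min s T))) \<tau>}"

text \<open>
  \<open>Y\<close> is a (real-valued) version of the essential supremum of the family \<open>\<Phi>\<close> of random variables.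
  Versions are determined up to null sets only. On the product space this is not enough to insert
  \<open>u = G \<omega>\<close>, since the graph of \<open>G\<close> may be a null set there (see \<open>density_process\<close> below); versions
  that are \<open>F T \<Otimes>\<^sub>M borel\<close>-measurable agree at \<open>(\<omega>, G \<omega>)\<close> almost surely.
\<close>

definition is_ess_sup :: "'b measure \<Rightarrow> ('b \<Rightarrow> real) set \<Rightarrow> ('b \<Rightarrow> real) \<Rightarrow> bool" where
  "is_ess_sup N \<Phi> Y \<longleftrightarrow>
     Y \<in> borel_measurable N \<and>
     (\<forall>X\<in>\<Phi>. AE \<omega> in N. X \<omega> \<le> Y \<omega>) \<and>
     (\<forall>Z\<in>borel_measurable N. (\<forall>X\<in>\<Phi>. AE \<omega> in N. X \<omega> \<le> Z \<omega>) \<longrightarrow> (AE \<omega> in N. Y \<omega> \<le> Z \<omega>))"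


section \<open>Initial enlargement and the density hypothesis\<close>

definition enlarged ::
    "'a measure \<Rightarrow> (real \<Rightarrow> 'a measure) \<Rightarrow> ('a \<Rightarrow> real) \<Rightarrow> real \<Rightarrow> 'a measure" where
  "enlarged M F G t =
     sigma (space M) (sets (F t) \<union> sets (vimage_algebra (space M) G borel))"

definition regular_cond_law ::
    "'a measure \<Rightarrow> 'a measure \<Rightarrow> ('a \<Rightarrow> real) \<Rightarrow> ('a \<Rightarrow> real measure) \<Rightarrow> bool" where
  "regular_cond_law M H G \<kappa> \<longleftrightarrow>
     \<kappa> \<in> H \<rightarrow>\<^sub>M prob_algebra borel \<and>
     (\<forall>B\<in>sets borel. AE \<omega> in M.
        measure (\<kappa> \<omega>) B = real_cond_exp M H (indicator (G -` B \<inter> space M)) \<omega>)"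

definition density_hypothesis ::
    "'a measure \<Rightarrow> real \<Rightarrow> ('a \<Rightarrow> real) \<Rightarrow> (real \<Rightarrow> 'a \<Rightarrow> real measure) \<Rightarrow> bool" where
  "density_hypothesis M T G \<kappa> \<longleftrightarrow>
     (\<forall>t\<in>{0..T}. AE \<omega> in M.
        absolutely_continuous (distr M borel G) (\<kappa> t \<omega>) \<and>
        absolutely_continuous (\<kappa> t \<omega>) (distr M borel G))"

text \<open>
  \<open>\<alpha> t u \<omega>\<close> is the density of \<open>\<kappa> t \<omega>\<close> with respect to the law of \<open>G\<close> at \<open>u\<close>.

  Joint measurability is with respect to \<open>F T \<Otimes>\<^sub>M borel\<close>, not \<open>M \<Otimes>\<^sub>M borel\<close>: under the density
  hypothesis \<open>G\<close> is not \<open>F T\<close>-measurable unless it is constant almost surely, and for atomless \<open>G\<close>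
  the graph \<open>{(\<omega>, u). u = G \<omega>}\<close> is a null set of \<open>M \<Otimes>\<^sub>M distr M borel G\<close> carrying every
  point \<open>(\<omega>, G \<omega>)\<close>. So an \<open>M \<Otimes>\<^sub>M borel\<close>-measurable density could be changed arbitrarily there,
  and its value at \<open>u = G \<omega>\<close> would be meaningless. As usual under the usual conditions, the
  martingales \<open>\<alpha> _ u\<close> are taken in their right-continuous versions with left limits.
\<close>

definition density_process ::
    "'a measure \<Rightarrow> (real \<Rightarrow> 'a measure) \<Rightarrow> real \<Rightarrow> ('a \<Rightarrow> real) \<Rightarrow>
     (real \<Rightarrow> 'a \<Rightarrow> real measure) \<Rightarrow> (real \<Rightarrow> real \<Rightarrow> 'a \<Rightarrow> real) \<Rightarrow> bool" where
  "density_process M F T G \<kappa> \<alpha> \<longleftrightarrow>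
     (\<forall>t\<in>{0..T}. (\<lambda>(\<omega>, u). \<alpha> t u \<omega>) \<in> borel_measurable (F T \<Otimes>\<^sub>M borel)) \<and>
     (\<forall>t\<in>{0..T}. \<forall>u. \<forall>\<omega>\<in>space M. 0 < \<alpha> t u \<omega>) \<and>
     (\<forall>t\<in>{0..T}. AE \<omega> in M.
        \<kappa> t \<omega> = density (distr M borel G) (\<lambda>u. ennreal (\<alpha> t u \<omega>))) \<and>
     (\<forall>u. martingale_on M F T (\<lambda>t. \<alpha> t u)) \<and>
     (\<forall>u. \<forall>\<omega>\<in>space M. cadlag_on T (\<lambda>t. \<alpha> t u \<omega>))"


section \<open>The product space\<close>

text \<open>
  The product measure space is completed, since \<open>M \<Otimes>\<^sub>M distr M borel G\<close> itself is never complete: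
  sections of its sets are Borel sets.
\<close>

definition prod_space :: "'a measure \<Rightarrow> ('a \<Rightarrow> real) \<Rightarrow> ('a \<times> real) measure" where
  "prod_space M G = completion (M \<Otimes>\<^sub>M distr M borel G)"

text \<open>
  The intersection of \<open>sets (F s \<Otimes>\<^sub>M borel)\<close> over \<open>s > t\<close>, with the convention \<open>F s = F T\<close> for
  \<open>s > T\<close>, which matters only at \<open>t = T\<close>.
\<close>

definition raw_prod_filtration ::
    "'a measure \<Rightarrow> (real \<Rightarrow> 'a measure) \<Rightarrow> real \<Rightarrow> real \<Rightarrow> ('a \<times> real) measure" where
  "raw_prod_filtration M F T t =
     sigma (space M \<times> UNIV) (\<Inter>s\<in>{t<..}. sets (F (min s T) \<Otimes>\<^sub>M borel))"

definition prod_filtration ::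
    "'a measure \<Rightarrow> (real \<Rightarrow> 'a measure) \<Rightarrow> real \<Rightarrow> ('a \<Rightarrow> real) \<Rightarrow> real \<Rightarrow> ('a \<times> real) measure" where
  "prod_filtration M F T G t =
     sigma (space M \<times> UNIV)
       (sets (raw_prod_filtration M F T t) \<union> null_sets (prod_space M G))"


section \<open>Payoffs and value families\<close>

definition payoff ::
    "real \<Rightarrow> (real \<Rightarrow> 'a \<Rightarrow> real) \<Rightarrow> ('a \<Rightarrow> real) \<Rightarrow> real \<Rightarrow> 'a \<Rightarrow> real" where
  "payoff T L \<xi> t \<omega> = L t \<omega> * indicator {0..<T} t + \<xi> \<omega> * indicator {T} t"

definition prod_payoff ::
    "real \<Rightarrow> (real \<Rightarrow> 'a \<Rightarrow> real) \<Rightarrow> ('a \<Rightarrow> real) \<Rightarrow> (real \<Rightarrow> real \<Rightarrow> 'a \<Rightarrow> real) \<Rightarrow>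
     real \<Rightarrow> real \<Rightarrow> 'a \<Rightarrow> real" where
  "prod_payoff T L \<xi> \<alpha> u t \<omega> =
     L t \<omega> * \<alpha> t u \<omega> * indicator {0..<T} t + \<xi> \<omega> * \<alpha> T u \<omega> * indicator {T} t"

definition enlarged_values ::
    "'a measure \<Rightarrow> (real \<Rightarrow> 'a measure) \<Rightarrow> real \<Rightarrow> ('a \<Rightarrow> real) \<Rightarrow> (real \<Rightarrow> 'a \<Rightarrow> real) \<Rightarrow>
     ('a \<Rightarrow> real) \<Rightarrow> real \<Rightarrow> ('a \<Rightarrow> real) set" where
  "enlarged_values M F T G L \<xi> t =
     {real_cond_exp M (enlarged M F G t) (\<lambda>\<omega>. payoff T L \<xi> (\<tau> \<omega>) \<omega>) |\<tau>.
        \<tau> \<in> stopping_times (space M) (enlarged M F G) T t}"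

definition prod_values ::
    "'a measure \<Rightarrow> (real \<Rightarrow> 'a measure) \<Rightarrow> real \<Rightarrow> ('a \<Rightarrow> real) \<Rightarrow> (real \<Rightarrow> 'a \<Rightarrow> real) \<Rightarrow>
     ('a \<Rightarrow> real) \<Rightarrow> (real \<Rightarrow> real \<Rightarrow> 'a \<Rightarrow> real) \<Rightarrow> real \<Rightarrow> ('a \<times> real \<Rightarrow> real) set" where
  "prod_values M F T G L \<xi> \<alpha> t =
     {real_cond_exp (prod_space M G) (prod_filtration M F T G t)
        (\<lambda>(\<omega>, u). prod_payoff T L \<xi> \<alpha> u (\<tau> (\<omega>, u)) \<omega>) |\<tau>.
        \<tau> \<in> stopping_times (space (prod_space M G)) (prod_filtration M F T G) T t}"

end

theory Submission
  imports Defs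
begin

text \<open>
  By the definition of the regular conditional laws, \<open>dens s (\<omega>, u) = \<alpha> s u \<omega>\<close> is the density on
  \<open>F s \<Otimes>\<^sub>M borel\<close> of the law of \<open>\<omega> \<mapsto> (\<omega>, G \<omega>)\<close> with respect to the product measure. It is positive, so
  the substitution \<open>u = G \<omega>\<close> respects almost sure relations between \<open>F T \<Otimes>\<^sub>M borel\<close>-measurable functions.
  Since a function with \<open>F s\<close>-measurable sections agrees almost everywhere with its conditional
  expectation given \<open>F s \<Otimes>\<^sub>M borel\<close>, the right-continuous completed product filtration at \<open>s\<close> is just
  \<open>F s \<Otimes>\<^sub>M borel\<close> up to null sets. Hence its stopping times correspond, under the substitution, to the stopping
  times of the enlarged filtration. Approximating a time from the right by times with finitely many
  values gives optional stopping for the density, and Bayes' formula then matches the two families of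
  conditional expectations member by member. Their essential suprema are countable suprema, which the
  substitution preserves.
\<close>

section \<open>Essential suprema and uniform integrability\<close>

text \<open>Three obstacles shape the details. The density \<open>\<alpha> s\<close> is jointly
  measurable only together with \<open>F T\<close>, although its sections are
  \<open>F s\<close>-measurable; every use that needs information up to \<open>s\<close> alone must
  first pass to a version. Next, a competitor for the essential supremum in the enlarged filtration
  is merely \<open>M\<close>-measurable and need not come from an \<open>F T\<close> times Borel
  measurable function on the product space, so minimality cannot be carried over as an almost sure
  relation; a pointwise countable supremum gets around this. Convexity takes its place: for each K
  >= 0 the integrated excess over K of payoff times density grows when the density is moved forward
  to \<open>T\<close>, and there it is bounded by the excess of the single integrable function
  \<open>H\<close>. This yields uniform integrability along the approximating times.\<close>

lemma is_ess_sup_unique: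
  assumes "is_ess_sup N \<Phi> Y" "is_ess_sup N \<Phi> Z"
  shows "AE x in N. Y x = Z x"
proof -
  have "AE x in N. Y x \<le> Z x" "AE x in N. Z x \<le> Y x"
    using assms unfolding is_ess_sup_def by blast+
  then show ?thesis by eventually_elim simp
qed

text \<open>An essential supremum sees its members only up to null sets; this permits exchanging
  conditional expectations for versions measurable before completion.\<close>

lemma is_ess_sup_cong_family:
  assumes "is_ess_sup N \<Phi> Y"
    and 1: "\<And>X. X \<in> \<Phi> \<Longrightarrow> \<exists>X'\<in>\<Psi>. AE x in N. X x = X' x"
    and 2: "\<And>X'. X' \<in> \<Psi> \<Longrightarrow> \<exists>X\<in>\<Phi>. AE x in N. X x = X' x"
  shows "is_ess_sup N \<Psi> Y"
  unfolding is_ess_sup_def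
proof (intro conjI ballI impI)
  show "Y \<in> borel_measurable N"
    using assms(1) by (simp add: is_ess_sup_def)
next
  fix X' assume "X' \<in> \<Psi>"
  then obtain X where X: "X \<in> \<Phi>" "AE x in N. X x = X' x" using 2 by blast
  then have "AE x in N. X x \<le> Y x" using assms(1) by (simp add: is_ess_sup_def)
  with X(2) show "AE x in N. X' x \<le> Y x" by eventually_elim simp
next
  fix Z assume Z: "Z \<in> borel_measurable N" "\<forall>X\<in>\<Psi>. AE x in N. X x \<le> Z x"
  have "AE x in N. X x \<le> Z x" if X: "X \<in> \<Phi>" for X
  proof -
    obtain X' where X': "X' \<in> \<Psi>" "AE x in N. X x = X' x" using 1[OF X] by blast
    then have "AE x in N. X' x \<le> Z x" using Z by blast
    with X'(2) show ?thesis by eventually_elim simp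
  qed
  then show "AE x in N. Y x \<le> Z x" using assms(1) Z(1) by (simp add: is_ess_sup_def)
qed

text \<open>Exhaustion: among all sequences in the family, one is chosen whose supremum is largest
  in integral, so that inserting a further member changes the supremum only on a null set. The cap
  \<open>b\<close> keeps the supremum finite at every point, which makes it a real function
  measurable for the smaller algebra \<open>H\<close>.\<close>

lemma ess_sup_countable:
  fixes N :: "'b measure" and b :: "'b \<Rightarrow> real"
  assumes "finite_measure N" and sub: "subalgebra N H"
    and ne: "\<Phi> \<noteq> {}" and meas: "\<Phi> \<subseteq> borel_measurable H" and b: "b \<in> borel_measurable H"
    and ub: "\<And>X. X \<in> \<Phi> \<Longrightarrow> AE x in N. X x \<le> b x"
  shows "\<exists>X::nat \<Rightarrow> 'b \<Rightarrow> real. range X \<subseteq> \<Phi> \<and>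
    (\<lambda>x. SUP n. min (X n x) (b x)) \<in> borel_measurable H \<and>
    is_ess_sup N \<Phi> (\<lambda>x. SUP n. min (X n x) (b x))"
proof -
  interpret finite_measure N by fact
  define S where "S X x = (SUP n. min (X n x) (b x))" for X :: "nat \<Rightarrow> 'b \<Rightarrow> real" and x
  \<comment> \<open>Since arctan is bounded and strictly increasing, all these integrals exist, and
    ordered suprema with equal integrals agree almost everywhere.\<close>
  define I where "I X = (\<integral>x. arctan (S X x) \<partial>N)" for X
  have bdd: "bdd_above (range (\<lambda>n. min (X n x) (b x)))" for X :: "nat \<Rightarrow> 'b \<Rightarrow> real" and x
    by (rule bdd_aboveI[of _ "b x"]) auto
  have upper: "min (X n x) (b x) \<le> S X x" for X n x
    unfolding S_def by (rule cSUP_upper[OF _ bdd]) simp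
  have SH: "S X \<in> borel_measurable H" if "range X \<subseteq> \<Phi>" for X
    unfolding S_def
    by (intro borel_measurable_cSUP borel_measurable_min bdd b) (use that meas in auto)
  have SN: "S X \<in> borel_measurable N" if "range X \<subseteq> \<Phi>" for X
    using measurable_from_subalg[OF sub SH[OF that]] .
  have arc: "\<bar>arctan y\<bar> \<le> pi/2" for y
    using arctan_lbound[of y] arctan_ubound[of y] by (simp add: abs_le_iff)
  have int: "integrable N (\<lambda>x. arctan (S X x))" if "range X \<subseteq> \<Phi>" for X
    using SN[OF that] arc
    by (intro integrable_const_bound[where B="pi/2"]) auto
  have Imono: "I X \<le> I Y" if "range X \<subseteq> \<Phi>" "range Y \<subseteq> \<Phi>" "\<And>x. S X x \<le> S Y x" for X Y
    unfolding I_def by (intro integral_mono int that arctan_monotone')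
  define c where "c = (SUP X\<in>{X. range X \<subseteq> \<Phi>}. I X)"
  have Ibdd: "bdd_above (I ` {X. range X \<subseteq> \<Phi>})"
  proof (rule bdd_aboveI)
    fix y assume "y \<in> I ` {X. range X \<subseteq> \<Phi>}"
    then obtain X where X: "range X \<subseteq> \<Phi>" "y = I X" by auto
    have "I X \<le> (\<integral>x. pi/2 \<partial>N)"
      unfolding I_def by (intro integral_mono int X) (use abs_le_D1[OF arc] in auto)
    then show "y \<le> (\<integral>x. pi/2 \<partial>N)" using X by simp
  qed
  obtain X0 where X0: "X0 \<in> \<Phi>" using ne by blast
  have "(\<lambda>_::nat. X0) \<in> {X. range X \<subseteq> \<Phi>}" using X0 by auto
  then have ne': "{X::nat \<Rightarrow> 'b \<Rightarrow> real. range X \<subseteq> \<Phi>} \<noteq> {}" by blast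
  have "\<exists>X. range X \<subseteq> \<Phi> \<and> c - 1 / Suc k < I X" for k
  proof -
    have "c - 1 / Suc k < c" by simp
    then show ?thesis
      unfolding c_def less_cSUP_iff[OF ne' Ibdd] by auto
  qed
  then obtain Xs where Xs: "\<And>k. range (Xs k) \<subseteq> \<Phi>" "\<And>k. c - 1 / Suc k < I (Xs k)" by metis
  \<comment> \<open>Pairing of indices merges the countably many nearly optimal sequences into a
    single optimal one.\<close>
  define Z where "Z n = Xs (fst (prod_decode n)) (snd (prod_decode n))" for n
  have Z: "range Z \<subseteq> \<Phi>" using Xs(1) unfolding Z_def by blast
  have "S (Xs k) x \<le> S Z x" for k x
  proof -
    have "min (Xs k n x) (b x) \<le> S Z x" for n
      using upper[of Z "prod_encode (k, n)" x] by (simp add: Z_def)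
    then show ?thesis unfolding S_def[of "Xs k"] by (intro cSUP_least) auto
  qed
  then have "c - 1 / Suc k < I Z" for k
    using Imono[OF Xs(1) Z, of k] Xs(2)[of k] by (meson less_le_trans)
  then have "\<And>k. c - 1 / Suc k \<le> I Z" by (simp add: less_imp_le)
  moreover have "(\<lambda>k. c - 1 / Suc k) \<longlonglongrightarrow> c - 0"
    using LIMSEQ_inverse_real_of_nat by (intro tendsto_diff) (simp_all add: inverse_eq_divide)
  ultimately have cZ: "c \<le> I Z" by (intro LIMSEQ_le_const2[of _ c]) auto
  have SZ: "AE x in N. X x \<le> S Z x" if X: "X \<in> \<Phi>" for X
  proof -
    \<comment> \<open>Prepending \<open>X\<close> to \<open>Z\<close> gives a competitor whose
      integral cannot exceed \<open>c\<close>.\<close>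
    define W where "W = case_nat X Z"
    have "W n \<in> \<Phi>" for n using X Z by (cases n) (auto simp: W_def)
    then have W: "range W \<subseteq> \<Phi>" by blast
    have ZW: "S Z x \<le> S W x" for x
    proof -
      have "min (Z n x) (b x) \<le> S W x" for n
        using upper[of W "Suc n" x] by (simp add: W_def)
      then show ?thesis unfolding S_def[of Z] by (intro cSUP_least) auto
    qed
    have "I W \<le> c" unfolding c_def using W by (intro cSUP_upper[OF _ Ibdd]) auto
    with cZ have "(\<integral>x. arctan (S W x) - arctan (S Z x) \<partial>N) \<le> 0"
      using int[OF W] int[OF Z] by (simp add: I_def)
    moreover have "0 \<le> (\<integral>x. arctan (S W x) - arctan (S Z x) \<partial>N)"
      using ZW by (intro integral_nonneg_AE) (auto simp: arctan_le_iff)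
    ultimately have "AE x in N. arctan (S W x) - arctan (S Z x) = 0"
      using ZW int[OF W] int[OF Z]
      by (subst integral_nonneg_eq_0_iff_AE[symmetric]) (auto simp: arctan_le_iff)
    with ub[OF X] show ?thesis
    proof eventually_elim
      case (elim x)
      then show ?case using upper[of W 0 x] by (simp add: W_def arctan_eq_iff)
    qed
  qed
  have "is_ess_sup N \<Phi> (S Z)"
    unfolding is_ess_sup_def
  proof (intro conjI ballI impI)
    show "S Z \<in> borel_measurable N" by (rule SN[OF Z])
    show "AE x in N. X x \<le> S Z x" if "X \<in> \<Phi>" for X by (rule SZ[OF that])
    fix Y assume "Y \<in> borel_measurable N" and Y: "\<forall>X\<in>\<Phi>. AE x in N. X x \<le> Y x"
    have "AE x in N. \<forall>n. Z n x \<le> Y x"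
      unfolding AE_all_countable using Y Z by auto
    then show "AE x in N. S Z x \<le> Y x"
    proof eventually_elim
      case (elim x)
      then show ?case unfolding S_def by (intro cSUP_least) (auto intro: min.coboundedI1)
    qed
  qed
  then show ?thesis using Z SH[OF Z] unfolding S_def by blast
qed

text \<open>The excess integrals of \<open>H\<close> tend to 0 as K grows, so the last hypothesis is
  uniform integrability, in the form that a convexity argument delivers. The conclusion is Vitali's
  convergence theorem.\<close>

lemma uniformly_integrable_limit:
  fixes f :: "nat \<Rightarrow> 'b \<Rightarrow> real" and g H :: "'b \<Rightarrow> real"
  assumes "finite_measure N"
    and f[measurable]: "\<And>n. f n \<in> borel_measurable N" and g[measurable]: "g \<in> borel_measurable N"
    and lim: "AE x in N. (\<lambda>n. f n x) \<longlonglongrightarrow> g x"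
    and H: "integrable N H"
    and ui: "\<And>n K. 0 \<le> K \<Longrightarrow>
      (\<integral>\<^sup>+x. ennreal (\<bar>f n x\<bar> - K) \<partial>N) \<le> (\<integral>\<^sup>+x. ennreal (H x - K) \<partial>N)"
  shows "integrable N g" and "(\<lambda>n. \<integral>x. f n x \<partial>N) \<longlonglongrightarrow> (\<integral>x. g x \<partial>N)"
proof -
  interpret finite_measure N by fact
  have [measurable]: "H \<in> borel_measurable N" using H by auto
  define a where "a K = (\<integral>\<^sup>+x. ennreal (H x - K) \<partial>N)" for K
  have a0: "a 0 < \<infinity>"
  proof -
    have "a 0 \<le> (\<integral>\<^sup>+x. ennreal (norm (H x)) \<partial>N)"
      unfolding a_def by (intro nn_integral_mono) (auto intro!: ennreal_leI)
    also have "\<dots> < \<infinity>" using H by (simp add: integrable_iff_bounded)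
    finally show ?thesis .
  qed
  have fint: "integrable N (f n)" for n
    using ui[of 0 n] a0 by (intro integrableI_bounded) (auto simp: a_def)
  \<comment> \<open>Fatou's lemma hands the excess bound on to the limit; at K = 0 it gives
    integrability.\<close>
  have ga: "(\<integral>\<^sup>+x. ennreal (\<bar>g x\<bar> - K) \<partial>N) \<le> a K" if "0 \<le> K" for K
  proof -
    have "(\<integral>\<^sup>+x. ennreal (\<bar>g x\<bar> - K) \<partial>N)
        = (\<integral>\<^sup>+x. liminf (\<lambda>n. ennreal (\<bar>f n x\<bar> - K)) \<partial>N)"
    proof (rule nn_integral_cong_AE, use lim in eventually_elim)
      case (elim x)
      have "(\<lambda>n. ennreal (\<bar>f n x\<bar> - K)) \<longlonglongrightarrow> ennreal (\<bar>g x\<bar> - K)"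
        by (intro tendsto_intros elim)
      then show ?case by (simp add: lim_imp_Liminf)
    qed
    also have "\<dots> \<le> liminf (\<lambda>n. \<integral>\<^sup>+x. ennreal (\<bar>f n x\<bar> - K) \<partial>N)"
      by (intro nn_integral_liminf) measurable
    also have "\<dots> \<le> limsup (\<lambda>n. \<integral>\<^sup>+x. ennreal (\<bar>f n x\<bar> - K) \<partial>N)"
      by (intro Liminf_le_Limsup) auto
    also have "\<dots> \<le> a K"
      unfolding a_def by (intro Limsup_bounded always_eventually allI ui that)
    finally show ?thesis .
  qed
  show gint: "integrable N g"
    using ga[of 0] a0 by (intro integrableI_bounded) auto
  have a_lim: "(\<lambda>k. a (real k)) \<longlonglongrightarrow> 0"
  proof -
    have "(\<lambda>k. \<integral>\<^sup>+x. ennreal (H x - real k) \<partial>N) \<longlonglongrightarrow> (\<integral>\<^sup>+x. 0 \<partial>N)"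
    proof (rule nn_integral_dominated_convergence[where w="\<lambda>x. ennreal (norm (H x))"])
      show "(\<integral>\<^sup>+x. ennreal (norm (H x)) \<partial>N) < \<infinity>" using H by (simp add: integrable_iff_bounded)
      show "AE x in N. (\<lambda>k. ennreal (H x - real k)) \<longlonglongrightarrow> 0"
      proof (rule AE_I2)
        fix x
        obtain m :: nat where "H x \<le> real m" using real_arch_simple by blast
        then have "\<forall>\<^sub>F k in sequentially. 0 = ennreal (H x - real k)"
          by (intro eventually_sequentiallyI[of m]) (simp add: ennreal_neg)
        then show "(\<lambda>k. ennreal (H x - real k)) \<longlonglongrightarrow> 0"
          by (rule Lim_transform_eventually[rotated]) simp
      qed
    qed (auto intro!: ennreal_leI)
    then show ?thesis by (simp add: a_def)
  qed
  define D where "D n = (\<integral>\<^sup>+x. ennreal (norm (f n x - g x)) \<partial>N)" for n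
  \<comment> \<open>Truncation to [-k, k] moves a number by exactly its excess over k. The L1
    distance thus splits into a bounded part, which tends to 0, and two excess parts of size at most
    \<open>a (real k)\<close>.\<close>
  define cut where "cut k y = max (- real k) (min (real k) y)" for k y
  have cutm[measurable]: "cut k \<in> borel_measurable borel" for k
    unfolding cut_def by measurable
  have "limsup D \<le> a (real k) + a (real k)" for k
  proof -
    define A where "A n = (\<integral>\<^sup>+x. ennreal \<bar>cut k (f n x) - cut k (g x)\<bar> \<partial>N)" for n
    have "A \<longlonglongrightarrow> (\<integral>\<^sup>+x. 0 \<partial>N)"
      unfolding A_def
    proof (rule nn_integral_dominated_convergence[where w="\<lambda>x. ennreal (2 * real k)"])
      show "AE x in N. (\<lambda>n. ennreal \<bar>cut k (f n x) - cut k (g x)\<bar>) \<longlonglongrightarrow> 0"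
        using lim
      proof eventually_elim
        case (elim x)
        have "(\<lambda>n. ennreal \<bar>cut k (f n x) - cut k (g x)\<bar>) \<longlonglongrightarrow> ennreal \<bar>cut k (g x) - cut k (g x)\<bar>"
          unfolding cut_def by (intro tendsto_intros elim)
        then show ?case by simp
      qed
      show "(\<integral>\<^sup>+x. ennreal (2 * real k) \<partial>N) < \<infinity>"
        by (simp add: ennreal_mult_eq_top_iff less_top[symmetric])
      show "AE x in N. ennreal \<bar>cut k (f n x) - cut k (g x)\<bar> \<le> ennreal (2 * real k)" for n
        by (rule AE_I2) (auto simp: cut_def intro!: ennreal_leI)
    qed measurable
    then have "(\<lambda>n. A n + (a (real k) + a (real k))) \<longlonglongrightarrow> 0 + (a (real k) + a (real k))"
      by (intro tendsto_intros) simp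
    then have lim': "limsup (\<lambda>n. A n + (a (real k) + a (real k))) = a (real k) + a (real k)"
      by (intro lim_imp_Limsup) auto
    have "D n \<le> A n + (a (real k) + a (real k))" for n
    proof -
      have "D n \<le> (\<integral>\<^sup>+x. ennreal \<bar>cut k (f n x) - cut k (g x)\<bar> +
          (ennreal (\<bar>f n x\<bar> - real k) + ennreal (\<bar>g x\<bar> - real k)) \<partial>N)"
        unfolding D_def
      proof (rule nn_integral_mono)
        fix x
        have "norm (f n x - g x) \<le> \<bar>cut k (f n x) - cut k (g x)\<bar> +
            (max 0 (\<bar>f n x\<bar> - real k) + max 0 (\<bar>g x\<bar> - real k))"
          unfolding cut_def by (auto simp: abs_if max_def min_def)
        then have "ennreal (norm (f n x - g x)) \<le> ennreal (\<bar>cut k (f n x) - cut k (g x)\<bar> +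
            (max 0 (\<bar>f n x\<bar> - real k) + max 0 (\<bar>g x\<bar> - real k)))"
          by (rule ennreal_leI)
        then show "ennreal (norm (f n x - g x)) \<le> ennreal \<bar>cut k (f n x) - cut k (g x)\<bar> +
          (ennreal (\<bar>f n x\<bar> - real k) + ennreal (\<bar>g x\<bar> - real k))"
          by (simp add: ennreal_plus ennreal_max_0)
      qed
      also have "\<dots> = A n + ((\<integral>\<^sup>+x. ennreal (\<bar>f n x\<bar> - real k) \<partial>N) + (\<integral>\<^sup>+x. ennreal (\<bar>g x\<bar> - real k) \<partial>N))"
        unfolding A_def by (simp add: nn_integral_add)
      also have "\<dots> \<le> A n + (a (real k) + a (real k))"
        using ui[of "real k" n] ga[of "real k"] by (intro add_mono) (auto simp: a_def)
      finally show ?thesis .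
    qed
    then have "limsup D \<le> limsup (\<lambda>n. A n + (a (real k) + a (real k)))"
      by (intro Limsup_mono) auto
    then show ?thesis using lim' by simp
  qed
  moreover have "(\<lambda>k. a (real k) + a (real k)) \<longlonglongrightarrow> 0 + 0" by (intro tendsto_intros a_lim)
  ultimately have "limsup D \<le> 0 + 0" by (intro LIMSEQ_le_const) auto
  then have "D \<longlonglongrightarrow> 0" by (intro tendsto_0_if_Limsup_eq_0_ennreal) simp
  then show "(\<lambda>n. \<integral>x. f n x \<partial>N) \<longlonglongrightarrow> (\<integral>x. g x \<partial>N)"
    unfolding D_def by (intro tendsto_L1_int[OF fint gint])
qed

section \<open>The law of the graph and functions with adapted sections\<close>

lemma sets_pair_measure_mono:
  assumes "space A = space B" "sets A \<subseteq> sets B"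
  shows "sets (A \<Otimes>\<^sub>M C) \<subseteq> sets (B \<Otimes>\<^sub>M C)"
  unfolding sets_pair_measure assms(1)
  by (rule sigma_sets_mono') (use assms(2) in auto)

text \<open>Dynkin's argument: the sets on which the integrals agree are closed under complements
  and countable disjoint unions. The complement step uses agreement on the whole space, hence
  \<open>space K \<in> E\<close>.\<close>

lemma AE_eq_generatorI:
  fixes f g :: "'b \<Rightarrow> real"
  assumes f: "integrable K f" and g: "integrable K g"
    and E: "Int_stable E" "sets K = sigma_sets (space K) E" "E \<subseteq> Pow (space K)" "space K \<in> E"
    and eq: "\<And>A. A \<in> E \<Longrightarrow> (LINT x:A|K. f x) = (LINT x:A|K. g x)"
  shows "AE x in K. f x = g x"
proof (rule density_unique_real[OF f g])
  fix A assume "A \<in> sets K"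
  then have "A \<in> sigma_sets (space K) E" by (simp only: E)
  with E(1,3) show "(LINT x:A|K. f x) = (LINT x:A|K. g x)"
  proof (induction rule: sigma_sets_induct_disjoint)
    case (basic A) then show ?case by (rule eq)
  next
    case empty show ?case by (simp add: set_lebesgue_integral_def)
  next
    case (compl A)
    then have A: "A \<in> sets K" by (simp only: E)
    have "(LINT x:space K - A|K. k x) = (LINT x:space K|K. k x) - (LINT x:A|K. k x)"
      if k: "integrable K k" for k :: "'b \<Rightarrow> real"
    proof -
      have "(LINT x:space K - A|K. k x) = (\<integral>x. indicator (space K) x *\<^sub>R k x - indicator A x *\<^sub>R k x \<partial>K)"
        unfolding set_lebesgue_integral_def
        by (intro Bochner_Integration.integral_cong) (auto simp: indicator_def)
      also have "\<dots> = (LINT x:space K|K. k x) - (LINT x:A|K. k x)"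
        unfolding set_lebesgue_integral_def
        by (intro Bochner_Integration.integral_diff integrable_mult_indicator k A sets.top)
      finally show ?thesis .
    qed
    then show ?case using f g eq[OF E(4)] compl(2) by simp
  next
    case (union A)
    then have A: "A i \<in> sets K" for i by (auto simp: E)
    have "(LINT x:(\<Union>i. A i)|K. k x) = (\<Sum>i. (LINT x:A i|K. k x))"
      if k: "integrable K k" for k :: "'b \<Rightarrow> real"
    proof (rule lebesgue_integral_countable_add)
      have "(\<Union>i. A i) \<in> sets K" using A by auto
      then show "set_integrable K (\<Union>i. A i) k"
        unfolding set_integrable_def using k by (rule integrable_mult_indicator)
    qed (use A union(1) in \<open>auto simp: disjoint_family_on_def\<close>)
    then show ?case using f g union(3) by simp
  qed
qed

section \<open>The law of the pair \<open>(\<omega>, G \<omega>)\<close> and its density\<close>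

locale initial_enlargement = filtered_prob_space M F T for M :: "'a measure" and F T +
  fixes G :: "'a \<Rightarrow> real" and \<kappa> :: "real \<Rightarrow> 'a \<Rightarrow> real measure" and \<alpha> :: "real \<Rightarrow> real \<Rightarrow> 'a \<Rightarrow> real"
  assumes G_measurable[measurable]: "G \<in> borel_measurable M"
    and cond_law: "s \<in> {0..T} \<Longrightarrow> regular_cond_law M (F s) G (\<kappa> s)"
    and density_process: "density_process M F T G \<kappa> \<alpha>"
begin

abbreviation law :: "real measure" where "law \<equiv> distr M borel G"
abbreviation N :: "('a \<times> real) measure" where "N \<equiv> M \<Otimes>\<^sub>M law"
abbreviation FB :: "real \<Rightarrow> ('a \<times> real) measure" where "FB s \<equiv> F s \<Otimes>\<^sub>M borel"
abbreviation Phat :: "('a \<times> real) measure" where "Phat \<equiv> prod_space M G"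
definition graph :: "'a \<Rightarrow> 'a \<times> real" where "graph \<omega> = (\<omega>, G \<omega>)"
definition dens :: "real \<Rightarrow> 'a \<times> real \<Rightarrow> real" where "dens s x = \<alpha> s (snd x) (fst x)"

sublocale law: prob_space law by (rule prob_space_distr) simp
sublocale Mlaw: pair_prob_space M law ..

lemma space_F[simp]: "s \<in> {0..T} \<Longrightarrow> space (F s) = space M"
  using subalgebra_F by (auto simp: subalgebra_def)

lemma sets_F: "s \<in> {0..T} \<Longrightarrow> sets (F s) \<subseteq> sets M"
  using subalgebra_F by (auto simp: subalgebra_def)

lemma top_F: "s \<in> {0..T} \<Longrightarrow> space M \<in> sets (F s)"
  using sets.top[of "F s"] by (metis space_F)

lemma space_FB: "s \<in> {0..T} \<Longrightarrow> space (FB s) = space M \<times> UNIV"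
  by (simp add: space_pair_measure)

lemma space_N: "space N = space M \<times> UNIV"
  by (simp add: space_pair_measure)

lemma sets_N: "sets N = sets (M \<Otimes>\<^sub>M borel)"
  by (intro sets_pair_measure_cong) auto

lemma subalgebra_FB: "s \<in> {0..T} \<Longrightarrow> subalgebra N (FB s)"
  unfolding subalgebra_def space_FB space_N sets_N
  using sets_pair_measure_mono[of "F s" M borel] sets_F by auto

lemma sets_FB_mono: "0 \<le> r \<Longrightarrow> r \<le> s \<Longrightarrow> s \<le> T \<Longrightarrow> sets (FB r) \<subseteq> sets (FB s)"
  by (rule sets_pair_measure_mono) (use mono_F in auto)

lemma measurable_FB_mono:
  "f \<in> FB r \<rightarrow>\<^sub>M K \<Longrightarrow> 0 \<le> r \<Longrightarrow> r \<le> s \<Longrightarrow> s \<le> T \<Longrightarrow> f \<in> FB s \<rightarrow>\<^sub>M K"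
  by (rule measurable_from_subalg[of _ "FB r"]) (auto simp: subalgebra_def space_FB sets_FB_mono[THEN subsetD])

lemma measurable_FB_N: "f \<in> FB s \<rightarrow>\<^sub>M K \<Longrightarrow> s \<in> {0..T} \<Longrightarrow> f \<in> N \<rightarrow>\<^sub>M K"
  using measurable_from_subalg[OF subalgebra_FB] .

lemma fst_FB: "f \<in> F s \<rightarrow>\<^sub>M K \<Longrightarrow> (\<lambda>x. f (fst x)) \<in> FB s \<rightarrow>\<^sub>M K"
  by (rule measurable_compose[OF measurable_fst])

lemma graph_measurable: "s \<in> {0..T} \<Longrightarrow> graph \<in> M \<rightarrow>\<^sub>M FB s"
  unfolding graph_def
  by (intro measurable_Pair measurable_from_subalg[OF subalgebra_F] measurable_ident_sets G_measurable) auto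

lemma graph_compose_measurable: "f \<in> FB s \<rightarrow>\<^sub>M K \<Longrightarrow> s \<in> {0..T} \<Longrightarrow> (\<lambda>\<omega>. f (graph \<omega>)) \<in> M \<rightarrow>\<^sub>M K"
  using measurable_compose[OF graph_measurable] .

lemma dens_measurable: "s \<in> {0..T} \<Longrightarrow> dens s \<in> borel_measurable (FB T)"
  using density_process unfolding density_process_def dens_def by (simp add: split_beta')

lemma dens_measurable_N[measurable]: "s \<in> {0..T} \<Longrightarrow> dens s \<in> borel_measurable N"
  using measurable_FB_N[OF dens_measurable] T_pos by auto

lemma dens_pos: "s \<in> {0..T} \<Longrightarrow> x \<in> space N \<Longrightarrow> 0 < dens s x"
  using density_process unfolding density_process_def dens_def space_N by (auto simp: mem_Times_iff)

lemma dens_section: "s \<in> {0..T} \<Longrightarrow> (\<lambda>\<omega>. dens s (\<omega>, u)) \<in> borel_measurable (F s)"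
  using density_process unfolding density_process_def dens_def martingale_on_def by simp

text \<open>On a rectangle \<open>A \<times> B\<close> with \<open>A\<close> in \<open>F s\<close>,
  both sides equal the integral of \<open>\<kappa> s \<omega>\<close> of \<open>B\<close> over
  \<open>A\<close>: on the left by the definition of the conditional law, on the right by Fubini and
  the density of \<open>\<kappa> s\<close>. The identity map under \<open>distr\<close> only
  restricts the measure to \<open>FB s\<close>, as \<open>\<kappa> s\<close> conditions on no more
  than \<open>F s\<close>.\<close>

lemma graph_law:
  assumes s: "s \<in> {0..T}"
  shows "distr M (FB s) graph = distr (density N (\<lambda>x. ennreal (dens s x))) (FB s) (\<lambda>x. x)"
    (is "?A = ?B")
proof -
  have idm: "(\<lambda>x. x) \<in> N \<rightarrow>\<^sub>M FB s" using measurable_FB_N[OF measurable_ident_sets s] by auto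
  note gm = graph_measurable[OF s] and [measurable] = dens_measurable_N[OF s]
  let ?E = "{a \<times> b |a b. a \<in> sets (F s) \<and> b \<in> sets (borel::real measure)}"
  have kF: "\<kappa> s \<in> F s \<rightarrow>\<^sub>M prob_algebra borel"
    using cond_law[OF s] by (simp add: regular_cond_law_def)
  have kprob: "prob_space (\<kappa> s \<omega>)" "sets (\<kappa> s \<omega>) = sets borel" if "\<omega> \<in> space M" for \<omega>
    using measurable_space[OF kF, of \<omega>] that s by (auto simp: space_prob_algebra)
  have [measurable]: "\<kappa> s \<in> M \<rightarrow>\<^sub>M subprob_algebra borel"
    by (rule measurable_prob_algebraD) (rule measurable_from_subalg[OF subalgebra_F[OF s] kF])
  interpret S: finite_measure_subalgebra M "F s"
    by unfold_locales (rule subalgebra_F[OF s])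
  interpret S: sigma_finite_subalgebra M "F s"
    by (rule finite_measure_subalgebra_is_sigma_finite) unfold_locales
  show ?thesis
  proof (rule measure_eqI_generator_eq)
    show "Int_stable ?E" by (rule Int_stable_pair_measure_generator)
    show "?E \<subseteq> Pow (space M \<times> UNIV)" using sets.sets_into_space[of _ "F s"] s by auto
    show "sets ?A = sigma_sets (space M \<times> UNIV) ?E" "sets ?B = sigma_sets (space M \<times> UNIV) ?E"
      using s by (simp_all add: sets_pair_measure)
    show "range (\<lambda>_::nat. space M \<times> UNIV) \<subseteq> ?E"
      by (auto intro!: exI[of _ "space M"] exI[of _ "UNIV :: real set"] top_F[OF s])
    show "(\<Union>i::nat. space M \<times> UNIV) = (space M \<times> UNIV :: ('a \<times> real) set)" by simp
    show "emeasure ?A (space M \<times> UNIV) \<noteq> \<infinity>"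
      using gm pair_measureI[OF top_F[OF s], of UNIV borel] by (subst emeasure_distr) (auto simp: emeasure_eq_measure)
    fix X assume "X \<in> ?E"
    then obtain A B where X: "X = A \<times> B" and A: "A \<in> sets (F s)" and B: "B \<in> sets borel" by auto
    have AM[measurable]: "A \<in> sets M" using A sets_F[OF s] by blast
    note [measurable] = B
    have "emeasure ?A X = emeasure M (A \<inter> (G -` B \<inter> space M))"
      using gm A B sets.sets_into_space[OF AM] unfolding X
      by (subst emeasure_distr) (auto simp: graph_def intro!: arg_cong[where f="emeasure M"])
    also have "\<dots> = ennreal (\<integral>\<omega>. indicator A \<omega> * indicator (G -` B \<inter> space M) \<omega> \<partial>M)"
      by (simp add: emeasure_eq_measure indicator_inter_arith[symmetric] Int_assoc)
    also have "(\<integral>\<omega>. indicator A \<omega> * indicator (G -` B \<inter> space M) \<omega> \<partial>M)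
        = (\<integral>\<omega>. indicator A \<omega> * real_cond_exp M (F s) (indicator (G -` B \<inter> space M)) \<omega> \<partial>M)"
      using S.real_cond_exp_intA[of "indicator (G -` B \<inter> space M)" A] A
      by (simp add: set_lebesgue_integral_def integrable_indicator_iff less_top[symmetric])
    also have "\<dots> = (\<integral>\<omega>. indicator A \<omega> * measure (\<kappa> s \<omega>) B \<partial>M)"
    proof (rule integral_cong_AE)
      have "AE \<omega> in M. measure (\<kappa> s \<omega>) B = real_cond_exp M (F s) (indicator (G -` B \<inter> space M)) \<omega>"
        using cond_law[OF s] B unfolding regular_cond_law_def by blast
      then show "AE \<omega> in M. indicator A \<omega> * real_cond_exp M (F s) (indicator (G -` B \<inter> space M)) \<omega>
          = indicator A \<omega> * measure (\<kappa> s \<omega>) B"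
        by eventually_elim simp
    qed measurable
    also have "ennreal \<dots> = (\<integral>\<^sup>+\<omega>. indicator A \<omega> * emeasure (\<kappa> s \<omega>) B \<partial>M)"
    proof (subst nn_integral_eq_integral[symmetric])
      have [measurable]: "(\<lambda>\<omega>. measure (\<kappa> s \<omega>) B) \<in> borel_measurable M"
        by (rule measurable_compose[OF _ measurable_measure_subprob_algebra]) measurable
      show "integrable M (\<lambda>\<omega>. indicator A \<omega> * measure (\<kappa> s \<omega>) B)"
        using kprob by (intro integrable_const_bound[where B=1])
          (auto simp: indicator_def intro!: AE_I2 prob_space.prob_le_1)
      show "(\<integral>\<^sup>+\<omega>. ennreal (indicator A \<omega> * measure (\<kappa> s \<omega>) B) \<partial>M)
          = (\<integral>\<^sup>+\<omega>. indicator A \<omega> * emeasure (\<kappa> s \<omega>) B \<partial>M)"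
        using finite_measure.emeasure_eq_measure[OF prob_space.finite_measure[OF kprob(1)]]
        by (intro nn_integral_cong) (simp add: indicator_def)
    qed simp
    also have "\<dots> = (\<integral>\<^sup>+\<omega>. indicator A \<omega> * emeasure (density law (\<lambda>u. ennreal (dens s (\<omega>, u)))) B \<partial>M)"
    proof (rule nn_integral_cong_AE)
      have "AE \<omega> in M. \<kappa> s \<omega> = density law (\<lambda>u. ennreal (dens s (\<omega>, u)))"
        using density_process s unfolding density_process_def dens_def by simp
      then show "AE \<omega> in M. indicator A \<omega> * emeasure (\<kappa> s \<omega>) B
          = indicator A \<omega> * emeasure (density law (\<lambda>u. ennreal (dens s (\<omega>, u)))) B"
        by eventually_elim simp
    qed
    also have "\<dots> = (\<integral>\<^sup>+\<omega>. (\<integral>\<^sup>+u. ennreal (dens s (\<omega>, u)) * indicator (A \<times> B) (\<omega>, u) \<partial>law) \<partial>M)"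
    proof (rule nn_integral_cong)
      fix \<omega> assume \<omega>: "\<omega> \<in> space M"
      have [measurable]: "(\<lambda>u. dens s (\<omega>, u)) \<in> borel_measurable law"
        by (rule measurable_compose[OF measurable_Pair1'[OF \<omega>] dens_measurable_N[OF s]])
      have "indicator A \<omega> * emeasure (density law (\<lambda>u. ennreal (dens s (\<omega>, u)))) B
          = indicator A \<omega> * (\<integral>\<^sup>+u. ennreal (dens s (\<omega>, u)) * indicator B u \<partial>law)"
        by (subst emeasure_density) auto
      also have "\<dots> = (\<integral>\<^sup>+u. indicator A \<omega> * (ennreal (dens s (\<omega>, u)) * indicator B u) \<partial>law)"
        by (rule nn_integral_cmult[symmetric]) measurable
      finally show "indicator A \<omega> * emeasure (density law (\<lambda>u. ennreal (dens s (\<omega>, u)))) B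
          = (\<integral>\<^sup>+u. ennreal (dens s (\<omega>, u)) * indicator (A \<times> B) (\<omega>, u) \<partial>law)"
        by (simp add: indicator_times mult_ac)
    qed
    also have "\<dots> = (\<integral>\<^sup>+x. ennreal (dens s x) * indicator (A \<times> B) x \<partial>N)"
      by (intro law.nn_integral_fst) measurable
    also have "\<dots> = emeasure ?B X"
      using idm A B unfolding X by (subst emeasure_distr) (auto simp: emeasure_density)
    finally show "emeasure ?A X = emeasure ?B X" .
  qed
qed

text \<open>Change of variables through the identity of laws. The left sides do not depend on
  \<open>s\<close>, which later allows the density at \<open>s\<close> to be exchanged for the one
  at \<open>T\<close>.\<close>

lemma
  fixes h :: "'a \<times> real \<Rightarrow> real"
  assumes s: "s \<in> {0..T}" and h: "h \<in> borel_measurable (FB s)"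
  shows integrable_graph_iff:
      "integrable M (\<lambda>\<omega>. h (graph \<omega>)) \<longleftrightarrow> integrable N (\<lambda>x. dens s x * h x)" (is ?th1)
    and integral_graph: "(\<integral>\<omega>. h (graph \<omega>) \<partial>M) = (\<integral>x. dens s x * h x \<partial>N)" (is ?th2)
proof -
  have idm: "(\<lambda>x. x) \<in> density N (\<lambda>x. ennreal (dens s x)) \<rightarrow>\<^sub>M FB s"
    using measurable_FB_N[OF measurable_ident_sets s] by auto
  have hN[measurable]: "h \<in> borel_measurable N" by (rule measurable_FB_N[OF h s])
  note [measurable] = dens_measurable_N[OF s]
  have pos: "AE x in N. 0 \<le> dens s x" using dens_pos[OF s] by (auto intro!: less_imp_le)
  have "integrable M (\<lambda>\<omega>. h (graph \<omega>)) \<longleftrightarrow> integrable (distr M (FB s) graph) h"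
    by (rule integrable_distr_eq[symmetric, OF graph_measurable[OF s] h])
  also have "\<dots> \<longleftrightarrow> integrable (density N (\<lambda>x. ennreal (dens s x))) h"
    unfolding graph_law[OF s] by (rule integrable_distr_eq[OF idm h])
  also have "\<dots> \<longleftrightarrow> integrable N (\<lambda>x. dens s x * h x)"
    using pos by (subst integrable_real_density) auto
  finally show ?th1 .
  have "(\<integral>\<omega>. h (graph \<omega>) \<partial>M) = integral\<^sup>L (distr M (FB s) graph) h"
    by (rule integral_distr[symmetric, OF graph_measurable[OF s] h])
  also have "\<dots> = integral\<^sup>L (density N (\<lambda>x. ennreal (dens s x))) h"
    unfolding graph_law[OF s] by (rule integral_distr[OF idm h])
  also have "\<dots> = (\<integral>x. dens s x * h x \<partial>N)"
    using pos by (subst integral_real_density) auto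
  finally show ?th2 .
qed

text \<open>Within \<open>FB T\<close> the law of \<open>graph\<close> and \<open>N\<close> have the
  same null sets. Strict positivity of the density gives the direction from the graph to the whole
  product space.\<close>

lemma AE_graph_iff:
  assumes P: "{x \<in> space N. P x} \<in> sets (FB T)"
  shows "(AE \<omega> in M. P (graph \<omega>)) \<longleftrightarrow> (AE x in N. P x)"
proof -
  have T: "T \<in> {0..T}" using T_pos by simp
  have idm: "(\<lambda>x. x) \<in> density N (\<lambda>x. ennreal (dens T x)) \<rightarrow>\<^sub>M FB T"
    using measurable_FB_N[OF measurable_ident_sets T] by auto
  note [measurable] = dens_measurable_N[OF T]
  have P': "{x \<in> space (FB T). P x} \<in> sets (FB T)" using P by (simp add: space_FB[OF T] space_N)
  have "(AE \<omega> in M. P (graph \<omega>)) \<longleftrightarrow> (AE x in distr M (FB T) graph. P x)"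
    by (rule AE_distr_iff[symmetric, OF graph_measurable[OF T] P'])
  also have "\<dots> \<longleftrightarrow> (AE x in density N (\<lambda>x. ennreal (dens T x)). P x)"
    unfolding graph_law[OF T] by (rule AE_distr_iff[OF idm P'])
  also have "\<dots> \<longleftrightarrow> (AE x in N. 0 < ennreal (dens T x) \<longrightarrow> P x)"
    by (rule AE_density) measurable
  also have "\<dots> \<longleftrightarrow> (AE x in N. P x)"
    using dens_pos[OF T] by (intro AE_cong) auto
  finally show ?thesis .
qed

lemma AE_graph_eq_iff:
  fixes f g :: "'a \<times> real \<Rightarrow> real"
  assumes "f \<in> borel_measurable (FB T)" "g \<in> borel_measurable (FB T)"
  shows "(AE \<omega> in M. f (graph \<omega>) = g (graph \<omega>)) \<longleftrightarrow> (AE x in N. f x = g x)"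
proof (rule AE_graph_iff)
  have "{x \<in> space (FB T). f x = g x} \<in> sets (FB T)" using assms by measurable
  then show "{x \<in> space N. f x = g x} \<in> sets (FB T)"
    using T_pos by (simp add: space_FB space_N)
qed

text \<open>By Fubini one integrates over \<open>M\<close> first, for fixed \<open>u\<close>; the
  section being \<open>F s\<close>-measurable, the indicator of \<open>A\<close> may be replaced by
  its conditional expectation. The clamp to [0, 1] alters that expectation only on a null set and
  makes the new integrand dominated by \<open>k\<close> at every point.\<close>

lemma integral_rectangle_section:
  fixes k :: "'a \<times> real \<Rightarrow> real"
  assumes s: "s \<in> {0..T}" and k: "integrable N k"
    and sec: "\<And>u. (\<lambda>\<omega>. k (\<omega>, u)) \<in> borel_measurable (F s)"
    and A[measurable]: "A \<in> sets M" and I[measurable]: "I \<in> sets borel"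
  defines "Z \<equiv> \<lambda>\<omega>. max 0 (min 1 (real_cond_exp M (F s) (indicator A) \<omega>))"
  shows "(LINT x:A \<times> I|N. k x) = (\<integral>x. Z (fst x) * indicator I (snd x) * k x \<partial>N)"
proof -
  interpret S: finite_measure_subalgebra M "F s"
    by unfold_locales (rule subalgebra_F[OF s])
  interpret S: sigma_finite_subalgebra M "F s"
    by (rule finite_measure_subalgebra_is_sigma_finite) unfold_locales
  have kN[measurable]: "k \<in> borel_measurable N" using k by auto
  have ZF: "Z \<in> borel_measurable (F s)" unfolding Z_def by measurable
  have ZM[measurable]: "Z \<in> borel_measurable M" by (rule measurable_from_subalg[OF subalgebra_F[OF s] ZF])
  have Z01: "0 \<le> Z \<omega>" "Z \<omega> \<le> 1" for \<omega> by (auto simp: Z_def)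
  have int0: "integrable M (indicator A :: 'a \<Rightarrow> real)"
    by (simp add: integrable_indicator_iff less_top[symmetric])
  have "AE \<omega> in M. 0 \<le> real_cond_exp M (F s) (indicator A) \<omega>"
    using int0 by (intro S.real_cond_exp_ge_c) auto
  moreover have "AE \<omega> in M. real_cond_exp M (F s) (indicator A) \<omega> \<le> 1"
    using int0 by (intro S.real_cond_exp_le_c) (auto simp: indicator_def)
  ultimately have Zae: "AE \<omega> in M. Z \<omega> = real_cond_exp M (F s) (indicator A) \<omega>"
    by eventually_elim (auto simp: Z_def)
  have intA: "integrable N (\<lambda>x. indicator (A \<times> I) x * k x)"
    using k by (rule Bochner_Integration.integrable_bound) (auto simp: indicator_def abs_mult)
  have bnd: "\<bar>Z a * indicator I b * y\<bar> \<le> \<bar>y\<bar>" for a b y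
    using Z01[of a] by (auto simp: indicator_def abs_mult intro: mult_left_le_one_le)
  have intZ: "integrable N (\<lambda>x. Z (fst x) * indicator I (snd x) * k x)"
    using k by (rule Bochner_Integration.integrable_bound) (use bnd in auto)
  have "(LINT x:A \<times> I|N. k x) = (\<integral>u. \<integral>\<omega>. indicator (A \<times> I) (\<omega>, u) * k (\<omega>, u) \<partial>M \<partial>law)"
    using intA unfolding set_lebesgue_integral_def
    by (subst Mlaw.integral_snd) (simp_all add: split_beta')
  also have "\<dots> = (\<integral>u. \<integral>\<omega>. Z \<omega> * indicator I u * k (\<omega>, u) \<partial>M \<partial>law)"
  proof (rule integral_cong_AE)
    show "(\<lambda>u. \<integral>\<omega>. indicator (A \<times> I) (\<omega>, u) * k (\<omega>, u) \<partial>M) \<in> borel_measurable law"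
      using Mlaw.integrable_snd[of "\<lambda>\<omega> u. indicator (A \<times> I) (\<omega>, u) * k (\<omega>, u)"] intA
      by (auto simp: split_beta')
    show "(\<lambda>u. \<integral>\<omega>. Z \<omega> * indicator I u * k (\<omega>, u) \<partial>M) \<in> borel_measurable law"
      using Mlaw.integrable_snd[of "\<lambda>\<omega> u. Z \<omega> * indicator I u * k (\<omega>, u)"] intZ
      by (auto simp: split_beta')
    have "AE u in law. integrable M (\<lambda>\<omega>. k (\<omega>, u))"
      using Mlaw.AE_integrable_snd[of "\<lambda>\<omega> u. k (\<omega>, u)"] k by (simp add: split_beta')
    then show "AE u in law. (\<integral>\<omega>. indicator (A \<times> I) (\<omega>, u) * k (\<omega>, u) \<partial>M)
        = (\<integral>\<omega>. Z \<omega> * indicator I u * k (\<omega>, u) \<partial>M)"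
    proof eventually_elim
      case (elim u)
      have [measurable]: "(\<lambda>\<omega>. k (\<omega>, u)) \<in> borel_measurable M" using elim by auto
      have iA: "integrable M (\<lambda>\<omega>. k (\<omega>, u) * indicator A \<omega>)"
        using elim by (rule Bochner_Integration.integrable_bound) (auto simp: indicator_def)
      have "(\<integral>\<omega>. Z \<omega> * indicator I u * k (\<omega>, u) \<partial>M)
          = indicator I u * (\<integral>\<omega>. k (\<omega>, u) * Z \<omega> \<partial>M)"
        by (subst integral_mult_right_zero[symmetric]) (simp add: mult_ac)
      also have "(\<integral>\<omega>. k (\<omega>, u) * Z \<omega> \<partial>M)
          = (\<integral>\<omega>. k (\<omega>, u) * real_cond_exp M (F s) (indicator A) \<omega> \<partial>M)"
        using Zae by (intro integral_cong_AE) auto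
      also have "\<dots> = (\<integral>\<omega>. k (\<omega>, u) * indicator A \<omega> \<partial>M)"
        by (rule S.real_cond_exp_intg(2)[OF iA sec]) simp
      finally show ?case
        by (simp add: indicator_times mult_ac flip: integral_mult_right_zero)
    qed
  qed
  also have "\<dots> = (\<integral>x. Z (fst x) * indicator I (snd x) * k x \<partial>N)"
    using intZ by (subst Mlaw.integral_snd) (simp_all add: split_beta')
  finally show ?thesis .
qed

lemma sigma_finite_subalgebra_FB: "s \<in> {0..T} \<Longrightarrow> sigma_finite_subalgebra N (FB s)"
  by (rule finite_measure_subalgebra_is_sigma_finite) (unfold_locales, rule subalgebra_FB)

text \<open>
  Rectangle integrals of \<open>h\<close> only see \<open>A\<close> through its conditional probability given \<open>F s\<close>, so they
  agree with those of the conditional expectation of \<open>h\<close> given \<open>F s \<Otimes>\<^sub>M borel\<close>.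
\<close>

lemma section_measurable_cond_exp:
  fixes h :: "'a \<times> real \<Rightarrow> real"
  assumes s: "s \<in> {0..T}" and h: "integrable N h"
    and sec: "\<And>u. (\<lambda>\<omega>. h (\<omega>, u)) \<in> borel_measurable (F s)"
  shows "AE x in N. real_cond_exp N (FB s) h x = h x"
proof -
  interpret S: sigma_finite_subalgebra N "FB s" by (rule sigma_finite_subalgebra_FB[OF s])
  let ?g = "real_cond_exp N (FB s) h"
  let ?E = "{a \<times> b |a b. a \<in> sets M \<and> b \<in> sets (borel::real measure)}"
  have hN[measurable]: "h \<in> borel_measurable N" using h by auto
  have gint: "integrable N ?g" by (rule S.real_cond_exp_int(1)[OF h])
  have gsec: "(\<lambda>\<omega>. ?g (\<omega>, u)) \<in> borel_measurable (F s)" for u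
    by (rule measurable_compose[OF _ borel_measurable_cond_exp]) (rule measurable_Pair2', simp)
  have "(LINT x:A|N. ?g x) = (LINT x:A|N. h x)" if "A \<in> ?E" for A
  proof -
    obtain B I where A: "A = B \<times> I" and B[measurable]: "B \<in> sets M" and I[measurable]: "I \<in> sets borel"
      using \<open>A \<in> ?E\<close> by auto
    define Z where "Z \<omega> = max 0 (min 1 (real_cond_exp M (F s) (indicator B) \<omega>))" for \<omega>
    have ZF[measurable]: "Z \<in> borel_measurable (F s)" unfolding Z_def by measurable
    have Z01: "0 \<le> Z \<omega>" "Z \<omega> \<le> 1" for \<omega> by (auto simp: Z_def)
    have ZI: "(\<lambda>x. Z (fst x) * indicator I (snd x)) \<in> borel_measurable (FB s)" by measurable
    note [measurable] = measurable_FB_N[OF ZI s]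
    have "\<bar>Z a * indicator I b * y\<bar> \<le> \<bar>y\<bar>" for a b y
      using Z01[of a] by (auto simp: indicator_def abs_mult intro: mult_left_le_one_le)
    then have "integrable N (\<lambda>x. Z (fst x) * indicator I (snd x) * h x)"
      by (intro Bochner_Integration.integrable_bound[OF h]) auto
    \<comment> \<open>The weight in the rectangle formula is \<open>FB s\<close>-measurable, so it
      does not distinguish \<open>h\<close> from its conditional expectation; the formula applies to
      both functions.\<close>
    from S.real_cond_exp_intg(2)[OF this ZI hN]
    show ?thesis
      unfolding A integral_rectangle_section[OF s h sec B I] integral_rectangle_section[OF s gint gsec B I]
      by (simp add: Z_def)
  qed
  then show ?thesis
  proof (intro AE_eq_generatorI[OF gint h, of ?E])
    show "Int_stable ?E" by (rule Int_stable_pair_measure_generator)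
    show "sets N = sigma_sets (space N) ?E" unfolding sets_N by (simp add: sets_pair_measure space_N)
    show "?E \<subseteq> Pow (space N)" using sets.sets_into_space[of _ M] by (auto simp: space_N)
    show "space N \<in> ?E" by (auto simp: space_N intro!: exI[of _ "space M"] exI[of _ "UNIV :: real set"])
  qed auto
qed

end

section \<open>Filtrations and stopping times\<close>

text \<open>For times with values in [t, T] the clamped indices add no condition: below 0 the level
  set is empty, above \<open>T\<close> it is the whole space.\<close>

lemma stopping_times_iff:
  assumes "0 \<le> t" "t \<le> T" and sp: "\<And>s. s \<in> {0..T} \<Longrightarrow> space (H s) = \<Omega>"
  shows "\<tau> \<in> stopping_times \<Omega> H T t \<longleftrightarrow>
    (\<forall>\<omega>\<in>\<Omega>. \<tau> \<omega> \<in> {t..T}) \<and> (\<forall>s\<in>{0..T}. {\<omega>\<in>\<Omega>. \<tau> \<omega> \<le> s} \<in> sets (H s))"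
proof -
  have sp': "space (H (max 0 (min s T))) = \<Omega>" for s
    using assms by (intro sp) auto
  have "(\<forall>s. {\<omega>\<in>\<Omega>. \<tau> \<omega> \<le> s} \<in> sets (H (max 0 (min s T)))) \<longleftrightarrow>
      (\<forall>s\<in>{0..T}. {\<omega>\<in>\<Omega>. \<tau> \<omega> \<le> s} \<in> sets (H s))" (is "?l \<longleftrightarrow> ?r")
    if range: "\<forall>\<omega>\<in>\<Omega>. \<tau> \<omega> \<in> {t..T}"
  proof (intro iffI allI ballI)
    fix s assume ?l "s \<in> {0..T}"
    moreover have "max 0 (min s T) = s" using \<open>s \<in> {0..T}\<close> by auto
    ultimately show "{\<omega>\<in>\<Omega>. \<tau> \<omega> \<le> s} \<in> sets (H s)" by metis
  next
    fix s assume r: ?r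
    consider "s < 0" | "s \<in> {0..T}" | "s > T" by fastforce
    then show "{\<omega>\<in>\<Omega>. \<tau> \<omega> \<le> s} \<in> sets (H (max 0 (min s T)))"
    proof cases
      case 1
      then have "{\<omega>\<in>\<Omega>. \<tau> \<omega> \<le> s} = {}" using range assms(1) by force
      then show ?thesis by (simp only: sets.empty_sets)
    next
      case 2
      then have "max 0 (min s T) = s" by auto
      with r 2 show ?thesis by auto
    next
      case 3
      then have "{\<omega>\<in>\<Omega>. \<tau> \<omega> \<le> s} = \<Omega>" using range by force
      then show ?thesis using sets.top[of "H (max 0 (min s T))"] by (simp only: sp')
    qed
  qed
  then show ?thesis
    unfolding stopping_times_def stopping_time_def pred_def sp' by auto
qed

text \<open>Rebuilds a time from measurable versions of its level sets at the (rational) levels in \<open>C\<close>.\<close>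

definition level_time :: "real \<Rightarrow> real set \<Rightarrow> (real \<Rightarrow> 'b set) \<Rightarrow> 'b \<Rightarrow> real" where
  "level_time T C A x = (INF r\<in>C. if x \<in> A r then r else T)"

text \<open>\<open>T\<close> is inserted because it may be irrational; it also makes the infimum
  range over a nonempty set.\<close>

definition levels :: "real \<Rightarrow> real \<Rightarrow> real set" where
  "levels t T = insert T ({t..T} \<inter> \<rat>)"

lemma countable_levels: "countable (levels t T)"
  unfolding levels_def by (simp add: countable_rat)

text \<open>Levels below \<open>s\<close> contribute the default \<open>T\<close>, the others
  contribute themselves, and rational levels come arbitrarily close to \<open>s\<close> from
  above.\<close>

lemma level_time_eq:
  assumes s: "s \<in> {t..T}" and A: "\<And>r. r \<in> levels t T \<Longrightarrow> x \<in> A r \<longleftrightarrow> s \<le> r"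
  shows "level_time T (levels t T) A x = s"
  unfolding level_time_def
proof (rule cInf_eq_non_empty)
  show "(\<lambda>r. if x \<in> A r then r else T) ` levels t T \<noteq> {}" by (simp add: levels_def)
  show "s \<le> y" if "y \<in> (\<lambda>r. if x \<in> A r then r else T) ` levels t T" for y
    using that A s by auto
  fix y assume y: "\<And>z. z \<in> (\<lambda>r. if x \<in> A r then r else T) ` levels t T \<Longrightarrow> y \<le> z"
  have "T \<in> levels t T" by (simp add: levels_def)
  from y[OF imageI[OF this]] have yT: "y \<le> T" by (simp split: if_splits)
  show "y \<le> s"
  proof (rule ccontr)
    assume "\<not> y \<le> s"
    then obtain r where r: "r \<in> \<rat>" "s < r" "r < y" using Rats_dense_in_real by (meson not_le)
    then have "r \<in> levels t T" using s yT by (auto simp: levels_def)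
    from y[OF imageI[OF this]] A[OF this] r show False by auto
  qed
qed

text \<open>The sets \<open>A r\<close> are arbitrary here: on the null set where chosen versions of
  the level sets are inconsistent, the rebuilt time must still take values in [t, T].\<close>

lemma level_time_range:
  assumes "t \<le> T" shows "level_time T (levels t T) A x \<in> {t..T}"
proof -
  have *: "\<And>y. y \<in> (\<lambda>r. if x \<in> A r then r else T) ` levels t T \<Longrightarrow> t \<le> y \<and> y \<le> T"
    using assms by (auto simp: levels_def)
  have "bdd_below ((\<lambda>r. if x \<in> A r then r else T) ` levels t T)"
    using * by (meson bdd_belowI)
  then have "(INF r\<in>levels t T. if x \<in> A r then r else T) \<le> (if x \<in> A T then T else T)"
    by (intro cINF_lower) (auto simp: levels_def)
  moreover have "t \<le> (INF r\<in>levels t T. if x \<in> A r then r else T)"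
    using * by (intro cINF_greatest) (auto simp: levels_def)
  ultimately show ?thesis by (simp add: level_time_def)
qed

lemma level_time_measurable:
  assumes "\<And>r. r \<in> levels t T \<Longrightarrow> A r \<in> sets K"
  shows "level_time T (levels t T) A \<in> borel_measurable K"
  unfolding level_time_def[abs_def]
proof (intro borel_measurable_cINF_real countable_levels)
  fix r assume "r \<in> levels t T"
  note [measurable] = assms[OF this]
  show "(\<lambda>x. if x \<in> A r then r else T) \<in> borel_measurable K" by measurable
qed

context initial_enlargement
begin

abbreviation PF :: "real \<Rightarrow> ('a \<times> real) measure" where "PF s \<equiv> prod_filtration M F T G s"
abbreviation GF :: "real \<Rightarrow> 'a measure" where "GF s \<equiv> enlarged M F G s"

lemma T_nonneg[simp]: "0 \<le> T" using T_pos by simp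

lemma T_in: "T \<in> {0..T}" by simp

section \<open>The right-continuous completed product filtration\<close>

lemma AE_Phat_iff: "(AE x in Phat. P x) \<longleftrightarrow> (AE x in N. P x)"
  unfolding prod_space_def by (rule AE_completion_iff)

lemma space_Phat: "space Phat = space N"
  by (simp add: prod_space_def)

lemma sets_raw_subset: "r > s \<Longrightarrow> 0 \<le> s \<Longrightarrow> sets (raw_prod_filtration M F T s) \<subseteq> sets (FB (min r T))"
proof -
  assume r: "r > s" "0 \<le> s"
  then have "min r T \<in> {0..T}" using T_pos by auto
  then have sp: "space (FB (min r T)) = space M \<times> UNIV" by (rule space_FB)
  have sub: "(\<Inter>s\<in>{s<..}. sets (FB (min s T))) \<subseteq> sets (FB (min r T))" using r by auto
  then have "(\<Inter>s\<in>{s<..}. sets (FB (min s T))) \<subseteq> Pow (space M \<times> UNIV)"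
    using sets.space_closed[of "FB (min r T)"] unfolding sp by blast
  then show ?thesis
    unfolding raw_prod_filtration_def
    using sets.sigma_sets_subset[OF sub] by (simp add: sp)
qed

lemma sets_FB_raw:
  assumes s: "s \<in> {0..T}" shows "sets (FB s) \<subseteq> sets (raw_prod_filtration M F T s)"
proof -
  have "sets (FB s) \<subseteq> (\<Inter>r\<in>{s<..}. sets (FB (min r T)))"
    using s by (intro INT_greatest sets_FB_mono) auto
  moreover have "(\<Inter>s\<in>{s<..}. sets (FB (min s T))) \<subseteq> sets (raw_prod_filtration M F T s)"
  proof -
    have "(\<Inter>s\<in>{s<..}. sets (FB (min s T))) \<subseteq> sets (FB (min (T+1) T))"
      using s by (intro INT_lower) auto
    also have "\<dots> \<subseteq> Pow (space M \<times> UNIV)"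
      using sets.space_closed[of "FB T"] space_FB[of T] by simp
    finally show ?thesis by (auto simp: raw_prod_filtration_def)
  qed
  ultimately show ?thesis by blast
qed

text \<open>The section lies in \<open>F r\<close> for every later \<open>r\<close>, hence in
  \<open>F s\<close> by right-continuity of \<open>F\<close>. Right-continuity is used for sections
  only; for the product algebras it is recovered up to null sets in
  \<open>raw_AE_FB\<close>.\<close>

lemma raw_section:
  assumes s: "s \<in> {0..T}" and A: "A \<in> sets (raw_prod_filtration M F T s)"
  shows "(\<lambda>\<omega>. (\<omega>, u)) -` A \<in> sets (F s)"
proof (cases "s < T")
  case True
  have "(\<lambda>\<omega>. (\<omega>, u)) -` A \<in> sets (F r)" if "r \<in> {s<..T}" for r
  proof -
    have "A \<in> sets (FB r)" using sets_raw_subset[of s r] that s A by (auto simp: min_def split: if_splits)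
    then show ?thesis by (rule sets_Pair2)
  qed
  then show ?thesis using right_continuous_F[of s] s True by auto
next
  \<comment> \<open>At \<open>T\<close> the intersection runs over indices beyond \<open>T\<close>,
    all of which stand for \<open>F T\<close>; hence the index \<open>T + 1\<close>.\<close>
  case False
  then have "s = T" using s by auto
  then have "A \<in> sets (FB T)" using sets_raw_subset[of T "T + 1"] s A by auto
  then show ?thesis unfolding \<open>s = T\<close> by (rule sets_Pair2)
qed

text \<open>The indicator of \<open>A\<close> has \<open>F s\<close>-measurable sections, so it
  agrees almost everywhere with its conditional expectation given \<open>FB s\<close>. The set where
  that expectation equals 1 serves as \<open>B\<close>.\<close>

lemma raw_AE_FB:
  assumes s: "s \<in> {0..T}" and A: "A \<in> sets (raw_prod_filtration M F T s)"
  shows "\<exists>B\<in>sets (FB s). AE x in N. x \<in> A \<longleftrightarrow> x \<in> B"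
proof -
  have "A \<in> sets (FB (min (T + 1) T))" using sets_raw_subset[of s "T + 1"] s A by auto
  then have AN[measurable]: "A \<in> sets N" using subalgebra_FB[of T] by (auto simp: subalgebra_def)
  have "AE x in N. real_cond_exp N (FB s) (indicator A) x = indicator A x"
  proof (rule section_measurable_cond_exp[OF s])
    show "integrable N (indicator A :: _ \<Rightarrow> real)"
      by (rule Mlaw.P.integrable_const_bound[where B=1]) auto
    fix u
    have "indicator ((\<lambda>\<omega>. (\<omega>, u)) -` A) \<in> borel_measurable (F s)"
      using raw_section[OF s A] by (rule borel_measurable_indicator)
    then show "(\<lambda>\<omega>. indicator A (\<omega>, u) :: real) \<in> borel_measurable (F s)"
      by (simp add: indicator_def[abs_def])
  qed
  then have "AE x in N. x \<in> A \<longleftrightarrow> x \<in> {x \<in> space (FB s). real_cond_exp N (FB s) (indicator A) x = 1}"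
    using AE_space
  proof eventually_elim
    case (elim x)
    then show ?case using s by (auto simp: indicator_def space_FB space_N split: if_splits)
  qed
  moreover have "{x \<in> space (FB s). real_cond_exp N (FB s) (indicator A) x = 1} \<in> sets (FB s)"
    by measurable
  ultimately show ?thesis by blast
qed

lemma prod_generator_closed:
  assumes s: "s \<in> {0..T}"
  shows "sets (raw_prod_filtration M F T s) \<union> null_sets Phat \<subseteq> Pow (space M \<times> UNIV)"
proof -
  have "sets (raw_prod_filtration M F T s) \<subseteq> sets (FB (min (T + 1) T))"
    using s by (intro sets_raw_subset) auto
  moreover have "sets (FB T) \<subseteq> Pow (space M \<times> UNIV)"
    using sets.space_closed[of "FB T"] space_FB[of T] by simp
  moreover have "null_sets Phat \<subseteq> Pow (space M \<times> UNIV)"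
    using sets.space_closed[of Phat] unfolding space_Phat space_N by (auto simp: null_sets_def)
  ultimately show ?thesis by auto
qed

lemma space_PF: "s \<in> {0..T} \<Longrightarrow> space (PF s) = space N"
  unfolding prod_filtration_def using prod_generator_closed[of s]
  by (simp add: space_measure_of_conv space_N)

lemma sets_PF_sigma: "s \<in> {0..T} \<Longrightarrow> sets (PF s) =
    sigma_sets (space M \<times> UNIV) (sets (raw_prod_filtration M F T s) \<union> null_sets Phat)"
  unfolding prod_filtration_def using prod_generator_closed[of s] by simp

text \<open>Sets with an \<open>FB s\<close> version are closed under the sigma-algebra operations
  and include both kinds of generators. Conversely, the symmetric difference of a set and its
  version is null, and all subsets of it belong to the completed filtration.\<close>

lemma sets_PF_iff:
  assumes s: "s \<in> {0..T}"
  shows "A \<in> sets (PF s) \<longleftrightarrow> A \<subseteq> space N \<and> (\<exists>B\<in>sets (FB s). AE x in N. x \<in> A \<longleftrightarrow> x \<in> B)"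
proof (intro iffI conjI)
  assume A: "A \<in> sets (PF s)"
  then show "A \<subseteq> space N" using sets.sets_into_space[of A "PF s"] space_PF[OF s] by auto
  from A have "A \<in> sigma_sets (space M \<times> UNIV) (sets (raw_prod_filtration M F T s) \<union> null_sets Phat)"
    by (simp only: sets_PF_sigma[OF s])
  then show "\<exists>B\<in>sets (FB s). AE x in N. x \<in> A \<longleftrightarrow> x \<in> B"
  proof induction
    case (Basic A)
    then show ?case
    proof
      assume "A \<in> null_sets Phat"
      then have "AE x in N. x \<in> A \<longleftrightarrow> x \<in> {}"
        unfolding AE_Phat_iff[symmetric] using AE_not_in by auto
      then show ?thesis by blast
    qed (rule raw_AE_FB[OF s])
  next
    case Empty
    then show ?case by (intro bexI[of _ "{}"]) auto
  next
    case (Compl A)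
    then obtain B where B: "B \<in> sets (FB s)" "AE x in N. x \<in> A \<longleftrightarrow> x \<in> B" by blast
    have "AE x in N. x \<in> space M \<times> UNIV - A \<longleftrightarrow> x \<in> space (FB s) - B"
      using B(2) by eventually_elim (simp add: space_FB[OF s])
    then show ?case using B(1) by blast
  next
    case (Union A)
    then obtain B where B: "\<And>i::nat. B i \<in> sets (FB s)" "\<And>i. AE x in N. x \<in> A i \<longleftrightarrow> x \<in> B i" by metis
    have "AE x in N. \<forall>i. x \<in> A i \<longleftrightarrow> x \<in> B i" using B(2) by (simp add: AE_all_countable)
    then have "AE x in N. x \<in> (\<Union>i. A i) \<longleftrightarrow> x \<in> (\<Union>i. B i)" by eventually_elim auto
    then show ?case using B(1) by blast
  qed
next
  assume "A \<subseteq> space N \<and> (\<exists>B\<in>sets (FB s). AE x in N. x \<in> A \<longleftrightarrow> x \<in> B)"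
  then obtain B where A: "A \<subseteq> space N" and B: "B \<in> sets (FB s)" and ae: "AE x in N. x \<in> A \<longleftrightarrow> x \<in> B" by blast
  have BN: "B \<in> sets Phat" using subalgebra_FB[OF s] B by (auto simp: subalgebra_def prod_space_def)
  have "AE x in Phat. \<not> (x \<in> A - B \<union> (B - A))" unfolding AE_Phat_iff using ae by eventually_elim auto
  then have n: "{x \<in> space Phat. x \<in> A - B \<union> (B - A)} \<in> null_sets Phat"
    unfolding prod_space_def by (subst (asm) completion.AE_iff_null_sets) (simp only: not_not)
  have null: "C \<in> sets (PF s)" if "C \<subseteq> A - B \<union> (B - A)" for C
  proof -
    have "C \<subseteq> {x \<in> space Phat. x \<in> A - B \<union> (B - A)}"
      using that A sets.sets_into_space[OF BN] by (auto simp: space_Phat)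
    then have "C \<in> null_sets Phat"
      using n unfolding prod_space_def by (rule completion.complete2)
    then show ?thesis by (simp add: sets_PF_sigma[OF s] sigma_sets.Basic)
  qed
  have "B \<in> sets (PF s)" using B sets_FB_raw[OF s] by (auto simp: sets_PF_sigma[OF s])
  then have "(B - (B - A)) \<union> (A - B) \<in> sets (PF s)"
    using null[of "B - A"] null[of "A - B"] by auto
  moreover have "(B - (B - A)) \<union> (A - B) = A" by auto
  ultimately show "A \<in> sets (PF s)" by simp
qed

lemma sets_FB_PF: "s \<in> {0..T} \<Longrightarrow> sets (FB s) \<subseteq> sets (PF s)"
  using sets_FB_raw by (auto simp: sets_PF_sigma)

lemma subalgebra_PF_FB: "s \<in> {0..T} \<Longrightarrow> subalgebra (PF s) (FB s)"
  using sets_FB_PF space_PF space_FB by (auto simp: subalgebra_def space_N)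

lemma subalgebra_PF: 
  assumes s: "s \<in> {0..T}" shows "subalgebra Phat (PF s)"
proof -
  have "A \<in> sets Phat" if "A \<in> sets (PF s)" for A
  proof -
    from that obtain B where A: "A \<subseteq> space N" and B: "B \<in> sets (FB s)" and ae: "AE x in N. x \<in> A \<longleftrightarrow> x \<in> B"
      unfolding sets_PF_iff[OF s] by blast
    have BN: "B \<in> sets (completion N)" using subalgebra_FB[OF s] B by (auto simp: subalgebra_def)
    show ?thesis
      unfolding prod_space_def
      by (rule completion.in_sets_AE[OF _ BN]) (use ae A in \<open>auto simp: AE_completion_iff\<close>)
  qed
  then show ?thesis by (auto simp: subalgebra_def space_PF[OF s] space_Phat)
qed

section \<open>The enlarged filtration as a preimage under \<open>graph\<close>\<close>

lemma enlarged_generator_closed: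
  "s \<in> {0..T} \<Longrightarrow> sets (F s) \<union> sets (vimage_algebra (space M) G borel) \<subseteq> Pow (space M)"
  using sets.space_closed[of "F s"] sets.space_closed[of "vimage_algebra (space M) G borel"] by simp

lemma space_GF: "s \<in> {0..T} \<Longrightarrow> space (GF s) = space M"
  unfolding enlarged_def using enlarged_generator_closed[of s] by (simp add: space_measure_of_conv)

lemma graph_GF_measurable:
  assumes s: "s \<in> {0..T}" shows "graph \<in> GF s \<rightarrow>\<^sub>M FB s"
  unfolding graph_def
proof (intro measurable_Pair)
  have gen: "sets (GF s) = sigma_sets (space M) (sets (F s) \<union> sets (vimage_algebra (space M) G borel))"
    unfolding enlarged_def using enlarged_generator_closed[OF s] by simp
  show "(\<lambda>\<omega>. \<omega>) \<in> GF s \<rightarrow>\<^sub>M F s"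
  proof (rule measurableI)
    fix A assume "A \<in> sets (F s)"
    then have "(\<lambda>\<omega>. \<omega>) -` A \<inter> space (GF s) = A"
      using sets.sets_into_space[of A "F s"] s space_GF[OF s] by auto
    then show "(\<lambda>\<omega>. \<omega>) -` A \<inter> space (GF s) \<in> sets (GF s)" using \<open>A \<in> sets (F s)\<close> by (simp add: gen)
  qed (use s space_GF[OF s] in simp)
  show "G \<in> borel_measurable (GF s)"
  proof (rule measurableI)
    fix B :: "real set" assume "B \<in> sets borel"
    then have "G -` B \<inter> space M \<in> sets (vimage_algebra (space M) G borel)" by (rule in_vimage_algebra)
    then show "G -` B \<inter> space (GF s) \<in> sets (GF s)" by (simp add: gen space_GF[OF s])
  qed simp
qed

text \<open>This description is exact, without null sets: both generators of \<open>GF s\<close> are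
  preimages of cylinders, and preimages commute with set operations.\<close>

lemma sets_GF_iff:
  assumes s: "s \<in> {0..T}"
  shows "A \<in> sets (GF s) \<longleftrightarrow> (\<exists>B\<in>sets (FB s). A = {\<omega> \<in> space M. graph \<omega> \<in> B})"
proof
  assume "A \<in> sets (GF s)"
  then have "A \<in> sigma_sets (space M) (sets (F s) \<union> sets (vimage_algebra (space M) G borel))"
    unfolding enlarged_def using enlarged_generator_closed[OF s] by simp
  then show "\<exists>B\<in>sets (FB s). A = {\<omega> \<in> space M. graph \<omega> \<in> B}"
  proof induction
    case (Basic A)
    then show ?case
    proof
      assume "A \<in> sets (F s)"
      then show ?thesis
        using sets.sets_into_space[of A "F s"] s
        by (intro bexI[of _ "A \<times> UNIV"] pair_measureI) (auto simp: graph_def)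
    next
      assume "A \<in> sets (vimage_algebra (space M) G borel)"
      then obtain B where "B \<in> sets borel" "A = G -` B \<inter> space M"
        by (auto simp: sets_vimage_algebra2)
      then show ?thesis
        using top_F[OF s] by (intro bexI[of _ "space M \<times> B"] pair_measureI) (auto simp: graph_def)
    qed
  next
    case Empty then show ?case by (intro bexI[of _ "{}"]) auto
  next
    case (Compl A)
    then obtain B where B: "B \<in> sets (FB s)" "A = {\<omega> \<in> space M. graph \<omega> \<in> B}" by blast
    then show ?case
      using sets.compl_sets[OF B(1)]
      by (intro bexI[of _ "space (FB s) - B"]) (auto simp: space_FB[OF s] graph_def)
  next
    case (Union A)
    then obtain B where B: "\<And>i::nat. B i \<in> sets (FB s)" "\<And>i. A i = {\<omega> \<in> space M. graph \<omega> \<in> B i}" by metis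
    then show ?case by (intro bexI[of _ "\<Union>i. B i"]) auto
  qed
next
  assume "\<exists>B\<in>sets (FB s). A = {\<omega> \<in> space M. graph \<omega> \<in> B}"
  then obtain B where B: "B \<in> sets (FB s)" "A = {\<omega> \<in> space M. graph \<omega> \<in> B}" by blast
  have "A = graph -` B \<inter> space (GF s)" using B(2) by (auto simp: space_GF[OF s])
  then show "A \<in> sets (GF s)" using measurable_sets[OF graph_GF_measurable[OF s] B(1)] by simp
qed

lemma subalgebra_GF: "s \<in> {0..T} \<Longrightarrow> subalgebra M (GF s)"
  unfolding subalgebra_def
  using measurable_sets[OF graph_measurable]
  by (auto simp: space_GF sets_GF_iff Int_def vimage_def conj_commute)

lemma null_sets_GF: "s \<in> {0..T} \<Longrightarrow> A \<in> null_sets M \<Longrightarrow> A \<in> sets (GF s)"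
proof -
  assume s: "s \<in> {0..T}" and A: "A \<in> null_sets M"
  then have "A \<in> sets (F s)" using null_sets_F mono_F[of 0 s] by auto
  then show "A \<in> sets (GF s)"
    unfolding enlarged_def using enlarged_generator_closed[OF s] by auto
qed

text \<open>Up to modification, the stopping times on the product space are those measurable before completion.\<close>

definition raw_times :: "real \<Rightarrow> ('a \<times> real \<Rightarrow> real) set" where
  "raw_times t = {\<tau>. \<tau> \<in> borel_measurable (FB T) \<and> (\<forall>x\<in>space N. \<tau> x \<in> {t..T}) \<and>
     (\<forall>s\<in>{0..T}. {x\<in>space N. \<tau> x \<le> s} \<in> sets (PF s))}"

lemma stopping_times_PF_iff:
  assumes "t \<in> {0..T}"
  shows "\<tau> \<in> stopping_times (space Phat) PF T t \<longleftrightarrow>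
    (\<forall>x\<in>space N. \<tau> x \<in> {t..T}) \<and> (\<forall>s\<in>{0..T}. {x\<in>space N. \<tau> x \<le> s} \<in> sets (PF s))"
  unfolding space_Phat using assms space_PF by (intro stopping_times_iff) auto

lemma raw_times_stopping: "t \<in> {0..T} \<Longrightarrow> \<tau> \<in> raw_times t \<Longrightarrow> \<tau> \<in> stopping_times (space Phat) PF T t"
  by (simp add: stopping_times_PF_iff raw_times_def)

lemma levels_subset: "t \<in> {0..T} \<Longrightarrow> r \<in> levels t T \<Longrightarrow> r \<in> {0..T}"
  by (auto simp: levels_def)

text \<open>The time is rebuilt from \<open>FB s\<close> versions of its level sets. Countably many
  levels suffice, so a single null set is lost; at any other \<open>s\<close>, almost sure equality
  with \<open>\<tau>\<close> supplies the version of the level set.\<close>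

lemma stopping_time_raw_version:
  assumes t: "t \<in> {0..T}" and \<tau>: "\<tau> \<in> stopping_times (space Phat) PF T t"
  shows "\<exists>\<sigma>\<in>raw_times t. AE x in N. \<tau> x = \<sigma> x"
proof -
  have rng: "\<And>x. x \<in> space N \<Longrightarrow> \<tau> x \<in> {t..T}"
    and lev: "\<And>s. s \<in> {0..T} \<Longrightarrow> {x\<in>space N. \<tau> x \<le> s} \<in> sets (PF s)"
    using \<tau> by (auto simp: stopping_times_PF_iff[OF t])
  have "\<forall>s\<in>{0..T}. \<exists>B\<in>sets (FB s). AE x in N. x \<in> {x\<in>space N. \<tau> x \<le> s} \<longleftrightarrow> x \<in> B"
    using lev sets_PF_iff by blast
  then obtain A where "\<forall>s\<in>{0..T}. A s \<in> sets (FB s) \<and>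
      (AE x in N. x \<in> {x\<in>space N. \<tau> x \<le> s} \<longleftrightarrow> x \<in> A s)"
    unfolding Bex_def by (rule bchoice[THEN exE])
  then have A: "\<And>s. s \<in> {0..T} \<Longrightarrow> A s \<in> sets (FB s)"
    and ae: "\<And>s. s \<in> {0..T} \<Longrightarrow> AE x in N. x \<in> {x\<in>space N. \<tau> x \<le> s} \<longleftrightarrow> x \<in> A s"
    by blast+
  let ?\<sigma> = "level_time T (levels t T) A"
  have "AE x in N. \<forall>r\<in>levels t T. x \<in> {x\<in>space N. \<tau> x \<le> r} \<longleftrightarrow> x \<in> A r"
    using ae levels_subset[OF t] by (subst AE_ball_countable[OF countable_levels]) auto
  then have eq: "AE x in N. \<tau> x = ?\<sigma> x"
    using AE_space
  proof eventually_elim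
    case (elim x)
    then show ?case using rng by (intro level_time_eq[symmetric]) auto
  qed
  moreover have "?\<sigma> \<in> raw_times t"
    unfolding raw_times_def
  proof (intro CollectI conjI ballI)
    show "?\<sigma> \<in> borel_measurable (FB T)"
      using A levels_subset[OF t] sets_FB_mono[of _ T] by (intro level_time_measurable) auto
    show "?\<sigma> x \<in> {t..T}" for x using t by (intro level_time_range) auto
    fix s assume s: "s \<in> {0..T}"
    have "AE x in N. x \<in> {x\<in>space N. ?\<sigma> x \<le> s} \<longleftrightarrow> x \<in> A s"
      using ae[OF s] eq by eventually_elim auto
    then show "{x\<in>space N. ?\<sigma> x \<le> s} \<in> sets (PF s)"
      unfolding sets_PF_iff[OF s] using A[OF s] by auto
  qed
  ultimately show ?thesis by blast
qed

lemma stopping_times_GF_iff: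
  assumes "t \<in> {0..T}"
  shows "\<tau> \<in> stopping_times (space M) (enlarged M F G) T t \<longleftrightarrow>
    (\<forall>\<omega>\<in>space M. \<tau> \<omega> \<in> {t..T}) \<and> (\<forall>s\<in>{0..T}. {\<omega>\<in>space M. \<tau> \<omega> \<le> s} \<in> sets (GF s))"
  using assms space_GF by (intro stopping_times_iff) auto

lemma graph_space[simp]: "\<omega> \<in> space M \<Longrightarrow> graph \<omega> \<in> space N"
  by (simp add: graph_def space_N)

text \<open>The level set and its \<open>FB s\<close> version both lie in \<open>FB T\<close>, so
  their almost sure equality survives the substitution. The exceptional set is null in
  \<open>M\<close>; by completeness all its subsets are null and belong to \<open>F 0\<close>, hence
  to \<open>GF s\<close>.\<close>

lemma raw_times_graph:
  assumes t: "t \<in> {0..T}" and \<sigma>: "\<sigma> \<in> raw_times t"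
  shows "(\<lambda>\<omega>. \<sigma> (graph \<omega>)) \<in> stopping_times (space M) (enlarged M F G) T t"
  unfolding stopping_times_GF_iff[OF t]
proof (intro conjI ballI)
  show "\<sigma> (graph \<omega>) \<in> {t..T}" if "\<omega> \<in> space M" for \<omega>
    using that \<sigma> by (simp add: raw_times_def)
  fix s assume s: "s \<in> {0..T}"
  have [measurable]: "\<sigma> \<in> borel_measurable (FB T)" using \<sigma> by (simp add: raw_times_def)
  obtain B where B: "B \<in> sets (FB s)" and ae: "AE x in N. x \<in> {x\<in>space N. \<sigma> x \<le> s} \<longleftrightarrow> x \<in> B"
    using \<sigma> s sets_PF_iff[OF s] unfolding raw_times_def by blast
  have [measurable]: "B \<in> sets (FB T)" using B s sets_FB_mono[of s T] by auto
  have "{x\<in>space (FB T). x \<in> {x\<in>space (FB T). \<sigma> x \<le> s} \<longleftrightarrow> x \<in> B} \<in> sets (FB T)" by measurable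
  then have "{x\<in>space N. x \<in> {x\<in>space N. \<sigma> x \<le> s} \<longleftrightarrow> x \<in> B} \<in> sets (FB T)"
    by (simp add: space_FB space_N)
  from AE_graph_iff[OF this, THEN iffD2, OF ae]
  have "AE \<omega> in M. \<sigma> (graph \<omega>) \<le> s \<longleftrightarrow> graph \<omega> \<in> B"
    using AE_space by eventually_elim simp
  then have n: "{\<omega> \<in> space M. \<not> (\<sigma> (graph \<omega>) \<le> s \<longleftrightarrow> graph \<omega> \<in> B)} \<in> null_sets M" (is "?n \<in> _")
    unfolding AE_iff_null_sets .
  have B': "{\<omega> \<in> space M. graph \<omega> \<in> B} \<in> sets (GF s)" using B by (auto simp: sets_GF_iff[OF s])
  have null: "C \<in> sets (GF s)" if "C \<subseteq> ?n" for C
    using null_sets_GF[OF s] complete2[OF that n] by blast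
  \<comment> \<open>Correcting the preimage of \<open>B\<close> on the exceptional set
    \<open>?n\<close> recovers the level set exactly.\<close>
  have "({\<omega> \<in> space M. graph \<omega> \<in> B} - {\<omega> \<in> ?n. graph \<omega> \<in> B}) \<union> {\<omega> \<in> ?n. \<sigma> (graph \<omega>) \<le> s} \<in> sets (GF s)"
    by (intro sets.Un sets.Diff B' null) blast+
  moreover have "({\<omega> \<in> space M. graph \<omega> \<in> B} - {\<omega> \<in> ?n. graph \<omega> \<in> B}) \<union> {\<omega> \<in> ?n. \<sigma> (graph \<omega>) \<le> s}
      = {\<omega>\<in>space M. \<sigma> (graph \<omega>) \<le> s}" by blast
  ultimately show "{\<omega>\<in>space M. \<sigma> (graph \<omega>) \<le> s} \<in> sets (GF s)" by (simp only:)
qed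

text \<open>The level sets factor through \<open>graph\<close> exactly, so the rebuilt time agrees
  with \<open>\<tau>\<close> at every point. Off the graph its stopping property is not visible
  directly; it holds because the relation between its level sets and \<open>A s\<close> is
  \<open>FB T\<close>-measurable and valid along the graph, hence \<open>N\<close>-almost
  everywhere.\<close>

lemma enlarged_time_factor:
  assumes t: "t \<in> {0..T}" and \<tau>: "\<tau> \<in> stopping_times (space M) (enlarged M F G) T t"
  shows "\<exists>\<sigma>\<in>raw_times t. \<forall>\<omega>\<in>space M. \<tau> \<omega> = \<sigma> (graph \<omega>)"
proof -
  have rng: "\<And>x. x \<in> space M \<Longrightarrow> \<tau> x \<in> {t..T}"
    and lev: "\<And>s. s \<in> {0..T} \<Longrightarrow> {x\<in>space M. \<tau> x \<le> s} \<in> sets (GF s)"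
    using \<tau> by (auto simp: stopping_times_GF_iff[OF t])
  have "\<forall>s\<in>{0..T}. \<exists>B\<in>sets (FB s). {x\<in>space M. \<tau> x \<le> s} = {\<omega> \<in> space M. graph \<omega> \<in> B}"
  proof
    fix s assume s: "s \<in> {0..T}"
    show "\<exists>B\<in>sets (FB s). {x\<in>space M. \<tau> x \<le> s} = {\<omega> \<in> space M. graph \<omega> \<in> B}"
      using lev[OF s] unfolding sets_GF_iff[OF s] .
  qed
  then obtain A where "\<forall>s\<in>{0..T}. A s \<in> sets (FB s) \<and>
      {x\<in>space M. \<tau> x \<le> s} = {\<omega> \<in> space M. graph \<omega> \<in> A s}"
    unfolding Bex_def by (rule bchoice[THEN exE])
  then have A: "\<And>s. s \<in> {0..T} \<Longrightarrow> A s \<in> sets (FB s)"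
    and eq: "\<And>s. s \<in> {0..T} \<Longrightarrow> {x\<in>space M. \<tau> x \<le> s} = {\<omega> \<in> space M. graph \<omega> \<in> A s}"
    by blast+
  have eq': "graph \<omega> \<in> A s \<longleftrightarrow> \<tau> \<omega> \<le> s" if "\<omega> \<in> space M" "s \<in> {0..T}" for \<omega> s
    using eq[OF that(2)] that(1) by (auto simp: set_eq_iff)
  let ?\<sigma> = "level_time T (levels t T) A"
  have \<tau>\<sigma>: "\<tau> \<omega> = ?\<sigma> (graph \<omega>)" if "\<omega> \<in> space M" for \<omega>
    using rng[OF that] eq'[OF that] levels_subset[OF t] by (intro level_time_eq[symmetric]) auto
  have \<sigma>m[measurable]: "?\<sigma> \<in> borel_measurable (FB T)"
    using A levels_subset[OF t] sets_FB_mono[of _ T] by (intro level_time_measurable) auto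
  have "?\<sigma> \<in> raw_times t"
    unfolding raw_times_def
  proof (intro CollectI conjI ballI)
    show "?\<sigma> x \<in> {t..T}" for x using t by (intro level_time_range) auto
    fix s assume s: "s \<in> {0..T}"
    have [measurable]: "A s \<in> sets (FB T)" using A[OF s] s sets_FB_mono[of s T] by auto
    have "{x\<in>space (FB T). x \<in> {x\<in>space (FB T). ?\<sigma> x \<le> s} \<longleftrightarrow> x \<in> A s} \<in> sets (FB T)" by measurable
    then have "{x\<in>space N. x \<in> {x\<in>space N. ?\<sigma> x \<le> s} \<longleftrightarrow> x \<in> A s} \<in> sets (FB T)"
      by (simp add: space_FB space_N)
    then have "AE x in N. x \<in> {x\<in>space N. ?\<sigma> x \<le> s} \<longleftrightarrow> x \<in> A s"
      by (rule AE_graph_iff[THEN iffD1]) (use \<tau>\<sigma> eq'[OF _ s] in auto)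
    then show "{x\<in>space N. ?\<sigma> x \<le> s} \<in> sets (PF s)"
      unfolding sets_PF_iff[OF s] using A[OF s] by auto
  qed (rule \<sigma>m)
  then show ?thesis using \<tau>\<sigma> by blast
qed

end

section \<open>Optional stopping\<close>

definition grid :: "real \<Rightarrow> real \<Rightarrow> nat \<Rightarrow> nat \<Rightarrow> real" where
  "grid t T n i = t + (T - t) * real i / real (Suc n)"

definition grid_index :: "real \<Rightarrow> real \<Rightarrow> nat \<Rightarrow> real \<Rightarrow> nat" where
  "grid_index t T n v = (LEAST i. v \<le> grid t T n i)"

definition grid_ceil :: "real \<Rightarrow> real \<Rightarrow> nat \<Rightarrow> real \<Rightarrow> real" where
  "grid_ceil t T n v = grid t T n (grid_index t T n v)"

lemma grid_last: "grid t T n (Suc n) = T"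
  by (simp add: grid_def)

lemma grid_range:
  assumes "t \<le> T" "i \<le> Suc n" shows "grid t T n i \<in> {t..T}"
proof -
  have "(T - t) * (real i / real (Suc n)) \<le> (T - t) * 1"
    using assms by (intro mult_left_mono) auto
  then show ?thesis using assms by (simp add: grid_def)
qed

lemma
  assumes v: "v \<in> {t..T}"
  shows grid_index_le: "grid_index t T n v \<le> Suc n"
    and grid_ceil_ge: "v \<le> grid_ceil t T n v"
    and grid_ceil_range: "grid_ceil t T n v \<in> {t..T}"
    and grid_ceil_le: "grid_ceil t T n v \<le> v + (T - t) / real (Suc n)"
proof -
  have last: "v \<le> grid t T n (Suc n)" using v by (simp add: grid_last)
  show le: "grid_index t T n v \<le> Suc n"
    unfolding grid_index_def using last by (rule Least_le)
  show "v \<le> grid_ceil t T n v"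
    unfolding grid_ceil_def grid_index_def using last by (rule LeastI)
  show "grid_ceil t T n v \<in> {t..T}"
    unfolding grid_ceil_def using v le by (intro grid_range) auto
  show "grid_ceil t T n v \<le> v + (T - t) / real (Suc n)"
  proof (cases "grid_index t T n v")
    case 0
    then show ?thesis using v by (simp add: grid_ceil_def grid_def add_increasing2)
  next
    \<comment> \<open>Minimality of the index excludes the previous grid point, so rounding up
      overshoots by at most one mesh width.\<close>
    case (Suc j)
    then have "\<not> v \<le> grid t T n j"
      unfolding grid_index_def by (intro not_less_Least) simp
    moreover have "grid t T n (Suc j) = grid t T n j + (T - t) / real (Suc n)"
      by (simp add: grid_def distrib_left add_divide_distrib)
    ultimately show ?thesis using Suc by (simp add: grid_ceil_def)
  qed
qed

lemma grid_ceil_T: "t \<le> T \<Longrightarrow> grid_ceil t T n T = T"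
  using grid_ceil_range[of T t T n] grid_ceil_ge[of T t T n] by simp

lemma grid_index_eq_iff:
  assumes "v \<in> {t..T}"
  shows "grid_index t T n v = i \<longleftrightarrow> v \<le> grid t T n i \<and> (\<forall>j<i. \<not> v \<le> grid t T n j)"
proof
  assume "grid_index t T n v = i"
  then show "v \<le> grid t T n i \<and> (\<forall>j<i. \<not> v \<le> grid t T n j)"
    using grid_ceil_ge[OF assms, of n] unfolding grid_ceil_def grid_index_def
    by (auto dest: not_less_Least)
next
  assume "v \<le> grid t T n i \<and> (\<forall>j<i. \<not> v \<le> grid t T n j)"
  then show "grid_index t T n v = i"
    unfolding grid_index_def by (intro Least_equality) (auto simp: not_le[symmetric])
qed

text \<open>The limit is taken within [v, infinity) because a grid value may equal \<open>v\<close>.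
  At \<open>v = T\<close> the approximation is constant, so a jump of the payoff at \<open>T\<close>
  does no harm.\<close>

lemma tendsto_grid_ceil:
  fixes f :: "real \<Rightarrow> real"
  assumes v: "v \<in> {t..T}" and f: "v < T \<Longrightarrow> (f \<longlongrightarrow> f v) (at_right v)"
  shows "(\<lambda>n. f (grid_ceil t T n v)) \<longlonglongrightarrow> f v"
proof (cases "v = T")
  case True
  then show ?thesis using v grid_ceil_T by simp
next
  case False
  have "{v..} - {v} = {v<..} - {v}" by auto
  then have "at v within {v..} = at_right v" by (simp only: at_within_def)
  then have "continuous (at v within {v..}) f"
    using False f v by (simp add: continuous_within)
  then show ?thesis
  proof (rule continuous_within_tendsto_compose)
    show "\<forall>\<^sub>F n in sequentially. grid_ceil t T n v \<in> {v..}" using grid_ceil_ge[OF v] by simp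
    have "(\<lambda>n. v + (T - t) * inverse (real (Suc n))) \<longlonglongrightarrow> v + (T - t) * 0"
      by (intro tendsto_intros LIMSEQ_inverse_real_of_nat)
    then have "(\<lambda>n. v + (T - t) / real (Suc n)) \<longlonglongrightarrow> v"
      unfolding divide_inverse mult_zero_right add_0_right .
    then show "(\<lambda>n. grid_ceil t T n v) \<longlonglongrightarrow> v"
      by (rule tendsto_sandwich[OF _ _ tendsto_const, rotated -1])
        (rule always_eventually, rule allI, rule grid_ceil_ge[OF v] grid_ceil_le[OF v])+
  qed
qed

lemma (in complete_measure) borel_measurable_AE_eq:
  fixes f g :: "'a \<Rightarrow> real"
  assumes f: "f \<in> borel_measurable M" and ae: "AE x in M. f x = g x"
  shows "g \<in> borel_measurable M"
proof (rule measurableI)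
  fix A :: "real set" assume "A \<in> sets borel"
  then have "f -` A \<inter> space M \<in> sets M" using f by (rule measurable_sets[rotated])
  then show "g -` A \<inter> space M \<in> sets M"
    by (rule in_sets_AE[rotated]) (use ae AE_space in \<open>auto elim: eventually_elim2\<close>)
qed simp

section \<open>The payoff and its integrable majorant\<close>

locale optimal_stopping = initial_enlargement M F T G \<kappa> \<alpha>
  for M :: "'a measure" and F T G \<kappa> \<alpha> +
  fixes L :: "real \<Rightarrow> 'a \<Rightarrow> real" and \<xi> :: "'a \<Rightarrow> real"
  assumes L_adapted: "s \<in> {0..T} \<Longrightarrow> L s \<in> borel_measurable (F s)"
    and L_cadlag: "\<omega> \<in> space M \<Longrightarrow> cadlag_on T (\<lambda>s. L s \<omega>)"
    and \<xi>_measurable: "\<xi> \<in> borel_measurable (F T)"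
    and integrable_sup: "(\<integral>\<^sup>+ \<omega>. (SUP s\<in>{0..T}. ennreal \<bar>L s \<omega>\<bar>) + ennreal \<bar>\<xi> \<omega>\<bar> \<partial>M) < \<infinity>"
begin

abbreviation pay :: "real \<Rightarrow> 'a \<Rightarrow> real" where "pay \<equiv> payoff T L \<xi>"

lemma pay_measurable:
  assumes s: "s \<in> {0..T}" shows "pay s \<in> borel_measurable (F s)"
proof (cases "s = T")
  case True
  then have "pay s = \<xi>" by (auto simp: payoff_def)
  then show ?thesis using \<xi>_measurable True by simp
next
  case False
  then have "pay s = L s" using s by (auto simp: payoff_def)
  then show ?thesis using L_adapted[OF s] by simp
qed

text \<open>On a right neighbourhood of a time before \<open>T\<close> the payoff is
  \<open>L\<close>; the switch to \<open>\<xi>\<close> can only be met when approaching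
  \<open>T\<close> from the left.\<close>

lemma pay_right_continuous:
  assumes "\<omega> \<in> space M" "0 \<le> v" "v < T"
  shows "((\<lambda>s. pay s \<omega>) \<longlongrightarrow> pay v \<omega>) (at_right v)"
proof -
  have lim: "((\<lambda>s. L s \<omega>) \<longlongrightarrow> L v \<omega>) (at_right v)"
    using L_cadlag[OF assms(1)] assms by (simp add: cadlag_on_def)
  have ev: "\<forall>\<^sub>F s in at_right v. L s \<omega> = pay s \<omega>"
    using assms unfolding eventually_at_right_field by (intro exI[of _ T]) (auto simp: payoff_def)
  have "L v \<omega> = pay v \<omega>" using assms by (simp add: payoff_def)
  with lim show ?thesis by (simp only: tendsto_cong[OF ev])
qed

lemma dens_right_continuous:
  assumes "x \<in> space N" "0 \<le> v" "v < T"
  shows "((\<lambda>s. dens s x) \<longlongrightarrow> dens v x) (at_right v)"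
  using density_process assms unfolding density_process_def dens_def cadlag_on_def
  by (auto simp: space_N)

text \<open>Restriction to countably many levels makes the supremum measurable; by right-continuity
  of \<open>L\<close> it is still the supremum over [0, T].\<close>

definition sup_pay :: "'a \<Rightarrow> ennreal" where
  "sup_pay \<omega> = (SUP s\<in>levels 0 T. ennreal \<bar>L s \<omega>\<bar>) + ennreal \<bar>\<xi> \<omega>\<bar>"

text \<open>Since \<open>enn2real\<close> sends infinity to 0, \<open>dom\<close> is a bound for the
  payoff only where \<open>sup_pay\<close> is finite.\<close>

definition dom :: "'a \<Rightarrow> real" where "dom \<omega> = enn2real (sup_pay \<omega>)"

lemma levels_T: "s \<in> levels 0 T \<Longrightarrow> s \<in> {0..T}"
  by (auto simp: levels_def)

lemma sup_pay_measurable: "sup_pay \<in> borel_measurable (F T)"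
proof -
  have [measurable]: "L s \<in> borel_measurable (F T)" if "s \<in> levels 0 T" for s
    using levels_T[OF that] mono_F[of s T]
    by (intro measurable_from_subalg[OF _ L_adapted[of s]]) (auto simp: subalgebra_def)
  note [measurable] = \<xi>_measurable and [simp] = countable_levels
  show ?thesis unfolding sup_pay_def[abs_def] by measurable
qed

lemma L_le_sup_levels:
  assumes \<omega>: "\<omega> \<in> space M" and s: "s \<in> {0..T}"
  shows "ennreal \<bar>L s \<omega>\<bar> \<le> (SUP s\<in>levels 0 T. ennreal \<bar>L s \<omega>\<bar>)"
proof (cases "s = T")
  case True
  then show ?thesis by (intro SUP_upper) (simp add: levels_def)
next
  case False
  then have sT: "s < T" using s by simp
  have "\<exists>r. r \<in> \<rat> \<and> s < r \<and> r < min T (s + 1 / real (Suc n))" for n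
    using Rats_dense_in_real[of s "min T (s + 1 / real (Suc n))"] sT by auto
  then obtain r where r: "\<And>n. r n \<in> \<rat>" "\<And>n. s < r n" "\<And>n. r n < T" "\<And>n. r n < s + 1 / real (Suc n)"
    by (metis min_less_iff_conj)
  have "(\<lambda>n. s + 1 / real (Suc n)) \<longlonglongrightarrow> s + 0"
    using LIMSEQ_inverse_real_of_nat by (intro tendsto_intros) (simp add: inverse_eq_divide)
  then have "r \<longlonglongrightarrow> s"
    by (intro tendsto_sandwich[of "\<lambda>_. s" r sequentially "\<lambda>n. s + 1 / real (Suc n)"])
       (use r in \<open>auto intro!: always_eventually less_imp_le\<close>)
  moreover have "((\<lambda>s. L s \<omega>) \<longlongrightarrow> L s \<omega>) (at_right s)"
    using L_cadlag[OF \<omega>] s sT by (simp add: cadlag_on_def)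
  ultimately have "((\<lambda>s. L s \<omega>) \<circ> r) \<longlonglongrightarrow> L s \<omega>"
    using r unfolding tendsto_at_iff_sequentially by auto
  then have "(\<lambda>n. ennreal \<bar>L (r n) \<omega>\<bar>) \<longlonglongrightarrow> ennreal \<bar>L s \<omega>\<bar>"
    unfolding comp_def by (intro tendsto_intros)
  then show ?thesis
  proof (rule LIMSEQ_le_const2)
    have "r n \<in> levels 0 T" for n
      using r(1-3)[of n] s by (auto simp: levels_def intro: less_imp_le)
    then show "\<exists>n0. \<forall>n\<ge>n0. ennreal \<bar>L (r n) \<omega>\<bar> \<le> (SUP s\<in>levels 0 T. ennreal \<bar>L s \<omega>\<bar>)"
      by (auto intro!: SUP_upper)
  qed
qed

lemma sup_pay_integral: "(\<integral>\<^sup>+\<omega>. sup_pay \<omega> \<partial>M) < \<infinity>"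
proof -
  have "(\<integral>\<^sup>+\<omega>. sup_pay \<omega> \<partial>M) \<le> (\<integral>\<^sup>+ \<omega>. (SUP s\<in>{0..T}. ennreal \<bar>L s \<omega>\<bar>) + ennreal \<bar>\<xi> \<omega>\<bar> \<partial>M)"
    unfolding sup_pay_def using levels_T
    by (intro nn_integral_mono add_right_mono SUP_subset_mono) auto
  then show ?thesis using integrable_sup by (rule le_less_trans)
qed

lemma sup_pay_measurable_M: "sup_pay \<in> borel_measurable M"
  by (rule measurable_from_subalg[OF subalgebra_F[OF T_in] sup_pay_measurable])

lemma sup_pay_finite: "AE \<omega> in M. sup_pay \<omega> < \<infinity>"
  using nn_integral_PInf_AE[OF sup_pay_measurable_M] sup_pay_integral
  by (simp add: less_top[symmetric])

lemma pay_le_dom: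
  assumes \<omega>: "\<omega> \<in> space M" and fin: "sup_pay \<omega> < \<infinity>" and s: "s \<in> {0..T}"
  shows "\<bar>pay s \<omega>\<bar> \<le> dom \<omega>"
proof -
  have "ennreal \<bar>pay s \<omega>\<bar> \<le> sup_pay \<omega>"
  proof (cases "s = T")
    case True
    then show ?thesis by (simp add: payoff_def sup_pay_def)
  next
    case False
    then have "pay s \<omega> = L s \<omega>" using s by (simp add: payoff_def)
    then show ?thesis
      using L_le_sup_levels[OF \<omega> s] unfolding sup_pay_def by (simp add: add_increasing2)
  qed
  also have "sup_pay \<omega> = ennreal (dom \<omega>)" using fin by (simp add: dom_def)
  finally show ?thesis by (subst (asm) ennreal_le_iff) (simp_all add: dom_def)
qed

lemma dom_measurable: "dom \<in> borel_measurable (F T)"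
  unfolding dom_def[abs_def] using sup_pay_measurable by measurable

lemma dom_integrable: "integrable M dom"
proof (rule integrableI_bounded)
  show "dom \<in> borel_measurable M"
    using measurable_from_subalg[OF subalgebra_F[OF T_in] dom_measurable] .
  have "(\<integral>\<^sup>+\<omega>. ennreal (norm (dom \<omega>)) \<partial>M) \<le> (\<integral>\<^sup>+\<omega>. sup_pay \<omega> \<partial>M)"
    by (intro nn_integral_mono) (auto simp: dom_def ennreal_enn2real_if)
  then show "(\<integral>\<^sup>+\<omega>. ennreal (norm (dom \<omega>)) \<partial>M) < \<infinity>"
    using sup_pay_integral by (rule le_less_trans)
qed

text \<open>One null set serves all times: finiteness of \<open>sup_pay\<close> is a single
  \<open>FB T\<close>-measurable condition, which passes from \<open>M\<close> to \<open>N\<close>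
  through the graph.\<close>

lemma AE_N_pay_le_dom: "AE x in N. \<forall>s\<in>{0..T}. \<bar>pay s (fst x)\<bar> \<le> dom (fst x)"
proof -
  have [measurable]: "(\<lambda>x. sup_pay (fst x)) \<in> borel_measurable (FB T)"
    by (rule fst_FB[OF sup_pay_measurable])
  have "{x \<in> space (FB T). sup_pay (fst x) < \<infinity>} \<in> sets (FB T)" by measurable
  then have "{x \<in> space N. sup_pay (fst x) < \<infinity>} \<in> sets (FB T)"
    by (simp add: space_FB space_N)
  then have "AE x in N. sup_pay (fst x) < \<infinity>"
    by (rule AE_graph_iff[THEN iffD1]) (use sup_pay_finite in \<open>simp add: graph_def\<close>)
  then show ?thesis
    using AE_space
  proof eventually_elim
    case (elim x)
    then show ?case using pay_le_dom[of "fst x"] by (auto simp: space_N)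
  qed
qed

text \<open>Its integral over \<open>N\<close> is the expectation of \<open>dom\<close>. It stands
  in for an integrable supremum of payoff times density.\<close>

definition H :: "'a \<times> real \<Rightarrow> real" where "H x = dens T x * dom (fst x)"

lemma H_integrable: "integrable N H"
  unfolding H_def[abs_def]
  using integrable_graph_iff[OF T_in fst_FB[OF dom_measurable]] dom_integrable by (simp add: graph_def)

section \<open>Exchanging the density at \<open>s\<close> for the density at
  \<open>T\<close>\<close>

lemma dens_pos_AE: "s \<in> {0..T} \<Longrightarrow> AE x in N. 0 < dens s x"
  using AE_space by eventually_elim (rule dens_pos)

lemma dens_integrable:
  assumes s: "s \<in> {0..T}" shows "integrable N (dens s)"
  using integrable_graph_iff[OF s, of "\<lambda>_. 1"] by simp

text \<open>Joint measurability of the density at \<open>s\<close> is given for \<open>FB T\<close>,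
  while its sections are \<open>F s\<close>-measurable; conditioning on \<open>FB s\<close>
  therefore changes it only on a null set.\<close>

lemma dens_version:
  assumes s: "s \<in> {0..T}"
  shows "\<exists>d\<in>borel_measurable (FB s). AE x in N. d x = dens s x"
  using section_measurable_cond_exp[OF s dens_integrable[OF s] dens_section[OF s]]
  by (intro bexI[of _ "real_cond_exp N (FB s) (dens s)"]) simp_all

text \<open>Both integrals are the expectation of \<open>h\<close> along the graph. This is the
  martingale property of the density on the product space, tested against
  \<open>FB s\<close>-measurable functions.\<close>

lemma dens_change:
  assumes s: "s \<in> {0..T}" and h: "h \<in> borel_measurable (FB s)"
  shows "integrable N (\<lambda>x. dens s x * h x) \<longleftrightarrow> integrable N (\<lambda>x. dens T x * h x)"
    and "(\<integral>x. dens s x * h x \<partial>N) = (\<integral>x. dens T x * h x \<partial>N)"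
proof -
  have hT: "h \<in> borel_measurable (FB T)" using measurable_FB_mono[OF h] s by auto
  show "integrable N (\<lambda>x. dens s x * h x) \<longleftrightarrow> integrable N (\<lambda>x. dens T x * h x)"
    using integrable_graph_iff[OF s h] integrable_graph_iff[OF T_in hT] by simp
  show "(\<integral>x. dens s x * h x \<partial>N) = (\<integral>x. dens T x * h x \<partial>N)"
    using integral_graph[OF s h] integral_graph[OF T_in hT] by simp
qed

text \<open>Conditional Jensen inequality for the function max 0 (y - K): on the set
  \<open>C\<close> where the excess at \<open>s\<close> is positive, the density may be exchanged
  for that at \<open>T\<close>, and there the integrand is at most its positive part.\<close>

lemma density_excess:
  assumes s: "s \<in> {0..T}" and p: "p \<in> borel_measurable (FB s)" and B: "B \<in> sets (FB s)"
    and int: "integrable N (\<lambda>x. dens T x * p x)" and K: "0 \<le> K"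
  shows "(\<integral>\<^sup>+x. indicator B x * ennreal (dens s x * p x - K) \<partial>N)
    \<le> (\<integral>\<^sup>+x. indicator B x * ennreal (dens T x * p x - K) \<partial>N)"
proof -
  obtain d where d[measurable]: "d \<in> borel_measurable (FB s)" and deq: "AE x in N. d x = dens s x"
    using dens_version[OF s] by blast
  note [measurable] = B p
  \<comment> \<open>The version \<open>d\<close> replaces \<open>dens s\<close> because the exchange
    of densities requires a set in \<open>FB s\<close>.\<close>
  define C where "C = {x \<in> space (FB s). x \<in> B \<and> K < d x * p x}"
  have C[measurable]: "C \<in> sets (FB s)" unfolding C_def by measurable
  have CN[measurable]: "C \<in> sets N" using C subalgebra_FB[OF s] by (auto simp: subalgebra_def)
  have BN: "B \<in> sets N" using B subalgebra_FB[OF s] by (auto simp: subalgebra_def)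
  have Cp: "(\<lambda>x. indicator C x * p x) \<in> borel_measurable (FB s)" by measurable
  have intT: "integrable N (\<lambda>x. dens T x * (indicator C x * p x))"
    using integrable_real_mult_indicator[OF CN int] by (simp add: mult_ac)
  have ints: "integrable N (\<lambda>x. dens s x * (indicator C x * p x))"
    using intT dens_change(1)[OF s Cp] by simp
  have intK: "integrable N (\<lambda>x. K * indicator C x)"
    by (intro integrable_mult_right Mlaw.P.integrable_const_bound[where B=1]) auto
  have "(\<integral>\<^sup>+x. indicator B x * ennreal (dens s x * p x - K) \<partial>N)
      = (\<integral>\<^sup>+x. ennreal (dens s x * (indicator C x * p x) - K * indicator C x) \<partial>N)"
  proof (rule nn_integral_cong_AE, use deq AE_space in eventually_elim)
    case (elim x)
    then show ?case
      by (auto simp: C_def indicator_def space_FB[OF s] space_N ennreal_neg)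
  qed
  also have "\<dots> = ennreal (\<integral>x. dens s x * (indicator C x * p x) - K * indicator C x \<partial>N)"
  proof (rule nn_integral_eq_integral)
    show "integrable N (\<lambda>x. dens s x * (indicator C x * p x) - K * indicator C x)"
      using ints intK by (rule Bochner_Integration.integrable_diff)
    show "AE x in N. 0 \<le> dens s x * (indicator C x * p x) - K * indicator C x"
      using deq by eventually_elim (auto simp: C_def indicator_def)
  qed
  also have "(\<integral>x. dens s x * (indicator C x * p x) - K * indicator C x \<partial>N)
      = (\<integral>x. dens T x * (indicator C x * p x) - K * indicator C x \<partial>N)"
    using ints intT intK dens_change(2)[OF s Cp] by simp
  also have "ennreal \<dots> \<le> ennreal (\<integral>x. indicator C x * max 0 (dens T x * p x - K) \<partial>N)"
  proof (intro ennreal_leI integral_mono)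
    show "integrable N (\<lambda>x. dens T x * (indicator C x * p x) - K * indicator C x)"
      using intT intK by (rule Bochner_Integration.integrable_diff)
    show "integrable N (\<lambda>x. indicator C x * max 0 (dens T x * p x - K))"
      using integrable_mult_indicator[OF CN Bochner_Integration.integrable_max[OF integrable_zero
        Bochner_Integration.integrable_diff[OF int Mlaw.P.integrable_const[of K]]]] by simp
  qed (auto simp: indicator_def)
  also have "\<dots> = (\<integral>\<^sup>+x. ennreal (indicator C x * max 0 (dens T x * p x - K)) \<partial>N)"
  proof (rule nn_integral_eq_integral[symmetric])
    show "integrable N (\<lambda>x. indicator C x * max 0 (dens T x * p x - K))"
      using integrable_mult_indicator[OF CN Bochner_Integration.integrable_max[OF integrable_zero
        Bochner_Integration.integrable_diff[OF int Mlaw.P.integrable_const[of K]]]] by simp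
  qed auto
  also have "\<dots> \<le> (\<integral>\<^sup>+x. indicator B x * ennreal (dens T x * p x - K) \<partial>N)"
    by (intro nn_integral_mono) (auto simp: C_def indicator_def ennreal_max_0)
  finally show ?thesis .
qed


section \<open>Payoffs stopped at grid times and their limits\<close>

definition stop_pay :: "('a \<times> real \<Rightarrow> real) \<Rightarrow> 'a \<times> real \<Rightarrow> real" where
  "stop_pay \<tau> x = pay (\<tau> x) (fst x)"

definition stop_dens :: "('a \<times> real \<Rightarrow> real) \<Rightarrow> 'a \<times> real \<Rightarrow> real" where
  "stop_dens \<tau> x = pay (\<tau> x) (fst x) * dens (\<tau> x) x"

lemma prod_payoff_eq:
  assumes "\<tau> x \<in> {0..T}"
  shows "prod_payoff T L \<xi> \<alpha> (snd x) (\<tau> x) (fst x) = stop_dens \<tau> x"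
  using assms by (auto simp: prod_payoff_def stop_dens_def payoff_def dens_def indicator_def)

text \<open>Stated over a semiring, as it is applied both to real and to extended nonnegative
  values.\<close>

lemma sum_grid_cells:
  fixes \<phi> :: "real \<Rightarrow> 'c::semiring_1"
  assumes "v \<in> {t..T}"
  shows "\<phi> (grid_ceil t T n v) = (\<Sum>i\<le>Suc n. of_bool (grid_index t T n v = i) * \<phi> (grid t T n i))"
proof -
  have "(\<Sum>i\<le>Suc n. of_bool (grid_index t T n v = i) * \<phi> (grid t T n i))
      = (\<Sum>i\<le>Suc n. if grid_index t T n v = i then \<phi> (grid t T n i) else 0)"
    by (intro sum.cong) auto
  also have "\<dots> = \<phi> (grid_ceil t T n v)"
    using grid_index_le[OF assms, of n] by (simp add: grid_ceil_def)
  finally show ?thesis ..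
qed

definition cell :: "real \<Rightarrow> ('a \<times> real \<Rightarrow> real) \<Rightarrow> nat \<Rightarrow> nat \<Rightarrow> ('a \<times> real) set" where
  "cell t \<sigma> n i = {x \<in> space N. grid_index t T n (\<sigma> x) = i}"

lemma raw_times_range: "\<sigma> \<in> raw_times t \<Longrightarrow> x \<in> space N \<Longrightarrow> \<sigma> x \<in> {t..T}"
  by (simp add: raw_times_def)

lemma raw_times_measurable: "\<sigma> \<in> raw_times t \<Longrightarrow> \<sigma> \<in> borel_measurable (FB T)"
  by (simp add: raw_times_def)

lemma grid_time: "t \<in> {0..T} \<Longrightarrow> i \<le> Suc n \<Longrightarrow> grid t T n i \<in> {0..T}"
  using grid_range[of t T i n] by auto

lemma cell_eq:
  assumes "\<sigma> \<in> raw_times t"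
  shows "cell t \<sigma> n i = {x \<in> space N. \<sigma> x \<le> grid t T n i} - (\<Union>j<i. {x \<in> space N. \<sigma> x \<le> grid t T n j})"
proof (rule set_eqI)
  fix x
  show "x \<in> cell t \<sigma> n i \<longleftrightarrow>
      x \<in> {x \<in> space N. \<sigma> x \<le> grid t T n i} - (\<Union>j<i. {x \<in> space N. \<sigma> x \<le> grid t T n j})"
  proof (cases "x \<in> space N")
    case True
    show ?thesis
      using True by (auto simp: cell_def grid_index_eq_iff[OF raw_times_range[OF assms True]])
  qed (simp add: cell_def)
qed

lemma cell_FB_T:
  assumes \<sigma>: "\<sigma> \<in> raw_times t" shows "cell t \<sigma> n i \<in> sets (FB T)"
proof -
  note [measurable] = raw_times_measurable[OF \<sigma>]
  have "{x \<in> space (FB T). \<sigma> x \<le> c} \<in> sets (FB T)" for c by measurable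
  then have "{x \<in> space N. \<sigma> x \<le> c} \<in> sets (FB T)" for c by (simp add: space_FB space_N)
  then show ?thesis unfolding cell_eq[OF \<sigma>] by (intro sets.Diff sets.finite_UN) auto
qed

text \<open>Rounding up is essential: membership in the cell is decided by the level sets at grid
  points up to the i-th, so it is known at that grid point, up to a null set.\<close>

lemma cell_adapted:
  assumes t: "t \<in> {0..T}" and \<sigma>: "\<sigma> \<in> raw_times t" and i: "i \<le> Suc n"
  shows "\<exists>B\<in>sets (FB (grid t T n i)). AE x in N. x \<in> cell t \<sigma> n i \<longleftrightarrow> x \<in> B"
proof -
  let ?q = "grid t T n"
  have q: "?q j \<in> {0..T}" if "j \<le> i" for j using grid_time[OF t] that i by simp
  have mono: "?q j \<le> ?q i" if "j \<le> i" for j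
    unfolding grid_def using that t by (intro add_left_mono divide_right_mono mult_left_mono) auto
  have sub: "sets (PF (?q j)) \<subseteq> sets (PF (?q i))" if "j \<le> i" for j
  proof -
    have "sets (FB (?q j)) \<subseteq> sets (FB (?q i))"
      using sets_FB_mono[of "?q j" "?q i"] q[OF that] q[OF order_refl] mono[OF that] by simp
    then show ?thesis
      unfolding subset_iff sets_PF_iff[OF q[OF that]] sets_PF_iff[OF q[OF order_refl]] by blast
  qed
  have "{x \<in> space N. \<sigma> x \<le> ?q j} \<in> sets (PF (?q i))" if "j \<le> i" for j
    using \<sigma> q[OF that] sub[OF that] by (auto simp: raw_times_def)
  then have "cell t \<sigma> n i \<in> sets (PF (?q i))"
    unfolding cell_eq[OF \<sigma>] by (intro sets.Diff sets.finite_UN) auto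
  then show ?thesis unfolding sets_PF_iff[OF q[OF order_refl]] by blast
qed

lemma pay_fst_measurable:
  assumes "s \<in> {0..T}"
  shows "(\<lambda>x. pay s (fst x)) \<in> borel_measurable (FB s)" "(\<lambda>x. pay s (fst x)) \<in> borel_measurable (FB T)"
proof -
  show *: "(\<lambda>x. pay s (fst x)) \<in> borel_measurable (FB s)" by (rule fst_FB[OF pay_measurable[OF assms]])
  show "(\<lambda>x. pay s (fst x)) \<in> borel_measurable (FB T)" using measurable_FB_mono[OF *] assms by simp
qed

lemma stop_grid_limit:
  assumes t: "t \<in> {0..T}" and \<sigma>: "\<sigma> \<in> raw_times t" and x: "x \<in> space N"
  shows "(\<lambda>n. stop_pay (\<lambda>x. grid_ceil t T n (\<sigma> x)) x) \<longlonglongrightarrow> stop_pay \<sigma> x"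
    and "(\<lambda>n. stop_dens (\<lambda>x. grid_ceil t T n (\<sigma> x)) x) \<longlonglongrightarrow> stop_dens \<sigma> x"
proof -
  have v: "\<sigma> x \<in> {t..T}" by (rule raw_times_range[OF \<sigma> x])
  have \<omega>: "fst x \<in> space M" using x by (auto simp: space_N)
  have pay: "(\<lambda>n. pay (grid_ceil t T n (\<sigma> x)) (fst x)) \<longlonglongrightarrow> pay (\<sigma> x) (fst x)"
    using v t by (intro tendsto_grid_ceil[where f="\<lambda>s. pay s (fst x)"] pay_right_continuous \<omega>) auto
  then show "(\<lambda>n. stop_pay (\<lambda>x. grid_ceil t T n (\<sigma> x)) x) \<longlonglongrightarrow> stop_pay \<sigma> x"
    by (simp add: stop_pay_def)
  have "(\<lambda>n. dens (grid_ceil t T n (\<sigma> x)) x) \<longlonglongrightarrow> dens (\<sigma> x) x"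
    using v t by (intro tendsto_grid_ceil[where f="\<lambda>s. dens s x"] dens_right_continuous x) auto
  with pay show "(\<lambda>n. stop_dens (\<lambda>x. grid_ceil t T n (\<sigma> x)) x) \<longlonglongrightarrow> stop_dens \<sigma> x"
    unfolding stop_dens_def by (intro tendsto_mult)
qed

lemma grid_stop_eq:
  assumes \<sigma>: "\<sigma> \<in> raw_times t" and x: "x \<in> space N"
  shows "stop_pay (\<lambda>x. grid_ceil t T n (\<sigma> x)) x = (\<Sum>i\<le>Suc n. indicator (cell t \<sigma> n i) x * pay (grid t T n i) (fst x))"
    and "stop_dens (\<lambda>x. grid_ceil t T n (\<sigma> x)) x =
      (\<Sum>i\<le>Suc n. indicator (cell t \<sigma> n i) x * (pay (grid t T n i) (fst x) * dens (grid t T n i) x))"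
proof -
  have ind: "of_bool (grid_index t T n (\<sigma> x) = i) = (indicator (cell t \<sigma> n i) x :: real)" for i
    using x by (simp add: cell_def indicator_def)
  show "stop_pay (\<lambda>x. grid_ceil t T n (\<sigma> x)) x = (\<Sum>i\<le>Suc n. indicator (cell t \<sigma> n i) x * pay (grid t T n i) (fst x))"
    unfolding stop_pay_def sum_grid_cells[OF raw_times_range[OF \<sigma> x], of "\<lambda>s. pay s (fst x)"] ind ..
  show "stop_dens (\<lambda>x. grid_ceil t T n (\<sigma> x)) x =
      (\<Sum>i\<le>Suc n. indicator (cell t \<sigma> n i) x * (pay (grid t T n i) (fst x) * dens (grid t T n i) x))"
    unfolding stop_dens_def sum_grid_cells[OF raw_times_range[OF \<sigma> x], of "\<lambda>s. pay s (fst x) * dens s x"] ind ..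
qed

lemma grid_stop_measurable:
  assumes t: "t \<in> {0..T}" and \<sigma>: "\<sigma> \<in> raw_times t"
  shows "stop_pay (\<lambda>x. grid_ceil t T n (\<sigma> x)) \<in> borel_measurable (FB T)"
    and "stop_dens (\<lambda>x. grid_ceil t T n (\<sigma> x)) \<in> borel_measurable (FB T)"
proof -
  have sp: "space (FB T) = space N" by (simp add: space_FB space_N)
  have "(\<lambda>x. \<Sum>i\<le>Suc n. indicator (cell t \<sigma> n i) x * pay (grid t T n i) (fst x)) \<in> borel_measurable (FB T)"
    using grid_time[OF t] cell_FB_T[OF \<sigma>]
    by (intro borel_measurable_sum borel_measurable_times borel_measurable_indicator pay_fst_measurable) auto
  then show "stop_pay (\<lambda>x. grid_ceil t T n (\<sigma> x)) \<in> borel_measurable (FB T)"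
    by (rule measurable_cong[THEN iffD2, rotated]) (simp only: sp grid_stop_eq[OF \<sigma>])
  have "(\<lambda>x. \<Sum>i\<le>Suc n. indicator (cell t \<sigma> n i) x * (pay (grid t T n i) (fst x) * dens (grid t T n i) x))
      \<in> borel_measurable (FB T)"
    using grid_time[OF t] cell_FB_T[OF \<sigma>]
    by (intro borel_measurable_sum borel_measurable_times borel_measurable_indicator pay_fst_measurable
        dens_measurable) auto
  then show "stop_dens (\<lambda>x. grid_ceil t T n (\<sigma> x)) \<in> borel_measurable (FB T)"
    by (rule measurable_cong[THEN iffD2, rotated]) (simp only: sp grid_stop_eq[OF \<sigma>])
qed

text \<open>Joint measurability in time is obtained from right-continuity: the stopped functions are
  pointwise limits of finite sums over cells.\<close>

lemma stop_measurable:
  assumes t: "t \<in> {0..T}" and \<sigma>: "\<sigma> \<in> raw_times t"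
  shows "stop_pay \<sigma> \<in> borel_measurable (FB T)" and "stop_dens \<sigma> \<in> borel_measurable (FB T)"
proof -
  have sp: "space (FB T) = space N" by (simp add: space_FB space_N)
  show "stop_pay \<sigma> \<in> borel_measurable (FB T)"
    by (rule borel_measurable_LIMSEQ_real[OF stop_grid_limit(1)[OF t \<sigma>] grid_stop_measurable(1)[OF t \<sigma>]])
      (simp add: sp)
  show "stop_dens \<sigma> \<in> borel_measurable (FB T)"
    by (rule borel_measurable_LIMSEQ_real[OF stop_grid_limit(2)[OF t \<sigma>] grid_stop_measurable(2)[OF t \<sigma>]])
      (simp add: sp)
qed

lemma dominated_integrable:
  assumes g: "g \<in> borel_measurable (FB T)" and ae: "AE x in N. \<bar>g x\<bar> \<le> dom (fst x)"
  shows "integrable N (\<lambda>x. dens T x * g x)"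
proof (rule Bochner_Integration.integrable_bound[OF H_integrable])
  show "(\<lambda>x. dens T x * g x) \<in> borel_measurable N"
    using dens_measurable_N[OF T_in] measurable_FB_N[OF g T_in] by (rule borel_measurable_times)
  show "AE x in N. norm (dens T x * g x) \<le> norm (H x)"
    using ae dens_pos_AE[OF T_in]
    by eventually_elim (auto simp: H_def abs_mult intro!: mult_left_mono)
qed

lemma stop_pay_le_dom:
  assumes "t \<in> {0..T}" "\<And>x. x \<in> space N \<Longrightarrow> \<tau> x \<in> {t..T}"
  shows "AE x in N. \<bar>stop_pay \<tau> x\<bar> \<le> dom (fst x)"
  using AE_N_pay_le_dom AE_space
proof eventually_elim
  case (elim x)
  then show ?case using assms(1) assms(2)[of x] by (auto simp: stop_pay_def)
qed

text \<open>On each cell the excess at the grid point is raised to the one at \<open>T\<close>,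
  where \<open>dom\<close> bounds the payoff. Each point lies in exactly one of the cells, so the
  indicators may stand outside the positive part.\<close>

lemma grid_excess:
  assumes t: "t \<in> {0..T}" and \<sigma>: "\<sigma> \<in> raw_times t" and K: "0 \<le> K"
  shows "(\<integral>\<^sup>+x. ennreal (\<bar>stop_dens (\<lambda>x. grid_ceil t T n (\<sigma> x)) x\<bar> - K) \<partial>N)
    \<le> (\<integral>\<^sup>+x. ennreal (H x - K) \<partial>N)"
proof -
  let ?q = "grid t T n"
  let ?f = "\<lambda>c s x. indicator c x * ennreal (dens s x * \<bar>pay s (fst x)\<bar> - K)"
  let ?g = "\<lambda>c s x. indicator c x * ennreal (dens T x * \<bar>pay s (fst x)\<bar> - K)"
  have ind: "of_bool (grid_index t T n (\<sigma> x) = i) = (indicator (cell t \<sigma> n i) x :: ennreal)"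
    if "x \<in> space N" for x i
    using that by (simp add: cell_def indicator_def)
  have cellN: "cell t \<sigma> n i \<in> sets N" for i
    using cell_FB_T[OF \<sigma>] subalgebra_FB[OF T_in] by (auto simp: subalgebra_def)
  have q: "?q i \<in> {0..T}" if "i \<le> Suc n" for i using grid_time[OF t that] .
  have payN: "(\<lambda>x. pay (?q i) (fst x)) \<in> borel_measurable N" if "i \<le> Suc n" for i
    using measurable_FB_N[OF pay_fst_measurable(2)[OF q[OF that]] T_in] .
  have cell_le: "(\<integral>\<^sup>+x. ?f (cell t \<sigma> n i) (?q i) x \<partial>N) \<le> (\<integral>\<^sup>+x. ?g (cell t \<sigma> n i) (?q i) x \<partial>N)"
    if i: "i \<le> Suc n" for i
  proof -
    obtain B where B: "B \<in> sets (FB (?q i))" and ae: "AE x in N. x \<in> cell t \<sigma> n i \<longleftrightarrow> x \<in> B"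
      using cell_adapted[OF t \<sigma> i] by blast
    have abs_m: "(\<lambda>x. \<bar>pay (?q i) (fst x)\<bar>) \<in> borel_measurable (FB (?q i))"
      using pay_fst_measurable(1)[OF q[OF i]] by (rule borel_measurable_abs)
    have abs_int: "integrable N (\<lambda>x. dens T x * \<bar>pay (?q i) (fst x)\<bar>)"
    proof (rule dominated_integrable)
      show "(\<lambda>x. \<bar>pay (?q i) (fst x)\<bar>) \<in> borel_measurable (FB T)"
        using pay_fst_measurable(2)[OF q[OF i]] by (rule borel_measurable_abs)
      show "AE x in N. \<bar>\<bar>pay (?q i) (fst x)\<bar>\<bar> \<le> dom (fst x)"
        using AE_N_pay_le_dom by eventually_elim (use q[OF i] in simp)
    qed
    have "(\<integral>\<^sup>+x. ?f (cell t \<sigma> n i) (?q i) x \<partial>N) = (\<integral>\<^sup>+x. ?f B (?q i) x \<partial>N)"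
      by (rule nn_integral_cong_AE, use ae in eventually_elim) (simp add: indicator_def)
    also have "\<dots> \<le> (\<integral>\<^sup>+x. ?g B (?q i) x \<partial>N)"
      by (rule density_excess[OF q[OF i] abs_m B abs_int K])
    also have "\<dots> = (\<integral>\<^sup>+x. ?g (cell t \<sigma> n i) (?q i) x \<partial>N)"
      by (rule nn_integral_cong_AE, use ae in eventually_elim) (simp add: indicator_def)
    finally show ?thesis .
  qed
  have "(\<integral>\<^sup>+x. ennreal (\<bar>stop_dens (\<lambda>x. grid_ceil t T n (\<sigma> x)) x\<bar> - K) \<partial>N)
      = (\<integral>\<^sup>+x. (\<Sum>i\<le>Suc n. ?f (cell t \<sigma> n i) (?q i) x) \<partial>N)"
  proof (rule nn_integral_cong)
    fix x assume x: "x \<in> space N"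
    have v: "\<sigma> x \<in> {t..T}" by (rule raw_times_range[OF \<sigma> x])
    have "0 \<le> dens (grid_ceil t T n (\<sigma> x)) x"
      using dens_pos[OF _ x] grid_ceil_range[OF v, of n] t by (intro less_imp_le) auto
    then have "\<bar>stop_dens (\<lambda>x. grid_ceil t T n (\<sigma> x)) x\<bar>
        = dens (grid_ceil t T n (\<sigma> x)) x * \<bar>pay (grid_ceil t T n (\<sigma> x)) (fst x)\<bar>"
      by (simp add: stop_dens_def abs_mult)
    then show "ennreal (\<bar>stop_dens (\<lambda>x. grid_ceil t T n (\<sigma> x)) x\<bar> - K)
        = (\<Sum>i\<le>Suc n. ?f (cell t \<sigma> n i) (?q i) x)"
      using sum_grid_cells[OF v, of "\<lambda>s. ennreal (dens s x * \<bar>pay s (fst x)\<bar> - K)" n]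
      by (simp only: ind[OF x])
  qed
  also have "\<dots> = (\<Sum>i\<le>Suc n. \<integral>\<^sup>+x. ?f (cell t \<sigma> n i) (?q i) x \<partial>N)"
  proof (rule nn_integral_sum)
    fix i assume "i \<in> {..Suc n}"
    then have i: "i \<le> Suc n" by simp
    note [measurable] = payN[OF i] dens_measurable_N[OF q[OF i]] cellN
    show "?f (cell t \<sigma> n i) (?q i) \<in> borel_measurable N" by measurable
  qed
  also have "\<dots> \<le> (\<Sum>i\<le>Suc n. \<integral>\<^sup>+x. ?g (cell t \<sigma> n i) (?q i) x \<partial>N)"
    by (intro sum_mono cell_le) simp
  also have "\<dots> = (\<integral>\<^sup>+x. (\<Sum>i\<le>Suc n. ?g (cell t \<sigma> n i) (?q i) x) \<partial>N)"
  proof (rule nn_integral_sum[symmetric])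
    fix i assume "i \<in> {..Suc n}"
    then have i: "i \<le> Suc n" by simp
    note [measurable] = payN[OF i] dens_measurable_N[OF T_in] cellN
    show "?g (cell t \<sigma> n i) (?q i) \<in> borel_measurable N" by measurable
  qed
  also have "\<dots> \<le> (\<integral>\<^sup>+x. ennreal (H x - K) \<partial>N)"
  proof (rule nn_integral_mono_AE, use AE_N_pay_le_dom AE_space in eventually_elim)
    case (elim x)
    have v: "\<sigma> x \<in> {t..T}" by (rule raw_times_range[OF \<sigma> elim(2)])
    have "(\<Sum>i\<le>Suc n. ?g (cell t \<sigma> n i) (?q i) x)
        = ennreal (dens T x * \<bar>pay (grid_ceil t T n (\<sigma> x)) (fst x)\<bar> - K)"
      using sum_grid_cells[OF v, of "\<lambda>s. ennreal (dens T x * \<bar>pay s (fst x)\<bar> - K)" n]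
      by (simp only: ind[OF elim(2)])
    also have "\<dots> \<le> ennreal (H x - K)"
      using elim(1) grid_ceil_range[OF v, of n] t dens_pos[OF T_in elim(2)]
      by (intro ennreal_leI diff_right_mono) (auto simp: H_def intro!: mult_left_mono)
    finally show ?case .
  qed
  finally show ?thesis .
qed

text \<open>On a single cell the time is deterministic, and \<open>A\<close> is known by then since
  every grid point is at least \<open>t\<close>; so the density can be exchanged cell by
  cell.\<close>

lemma grid_optional_stopping:
  assumes t: "t \<in> {0..T}" and \<sigma>: "\<sigma> \<in> raw_times t" and A: "A \<in> sets (FB t)"
  shows "(\<integral>x. indicator A x * stop_dens (\<lambda>x. grid_ceil t T n (\<sigma> x)) x \<partial>N)
    = (\<integral>x. dens T x * (indicator A x * stop_pay (\<lambda>x. grid_ceil t T n (\<sigma> x)) x) \<partial>N)"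
proof -
  let ?q = "grid t T n"
  have q: "?q i \<in> {0..T}" if "i \<le> Suc n" for i using grid_time[OF t that] .
  define p where "p i x = indicator A x * (indicator (cell t \<sigma> n i) x * pay (?q i) (fst x))" for i x
  have cell: "integrable N (\<lambda>x. dens (?q i) x * p i x) \<and> integrable N (\<lambda>x. dens T x * p i x) \<and>
      (\<integral>x. dens (?q i) x * p i x \<partial>N) = (\<integral>x. dens T x * p i x \<partial>N)"
    if i: "i \<le> Suc n" for i
  proof -
    obtain B where B[measurable]: "B \<in> sets (FB (?q i))" and ae: "AE x in N. x \<in> cell t \<sigma> n i \<longleftrightarrow> x \<in> B"
      using cell_adapted[OF t \<sigma> i] by blast
    have "t \<le> ?q i" using grid_range[of t T i n] t i by simp
    then have Aq[measurable]: "A \<in> sets (FB (?q i))"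
      using A sets_FB_mono[of t "?q i"] t q[OF i] by auto
    note [measurable] = pay_fst_measurable(1)[OF q[OF i]]
    \<comment> \<open>\<open>h\<close> is \<open>p i\<close> with the cell replaced by its version
      \<open>B\<close>, which makes it measurable at the grid point, as the exchange
      demands.\<close>
    define h where "h x = indicator A x * (indicator B x * pay (?q i) (fst x))" for x
    have hm: "h \<in> borel_measurable (FB (?q i))" unfolding h_def[abs_def] by measurable
    have hT: "h \<in> borel_measurable (FB T)" using measurable_FB_mono[OF hm] q[OF i] by simp
    have ph: "AE x in N. p i x = h x"
      using ae by eventually_elim (simp add: p_def h_def indicator_def)
    have pm: "p i \<in> borel_measurable N"
    proof -
      have "A \<in> sets (FB T)" using A sets_FB_mono[of t T] t by auto
      then have "p i \<in> borel_measurable (FB T)"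
        unfolding p_def[abs_def] using cell_FB_T[OF \<sigma>] pay_fst_measurable(2)[OF q[OF i]]
        by (intro borel_measurable_times borel_measurable_indicator) auto
      then show ?thesis by (rule measurable_FB_N[OF _ T_in])
    qed
    have hN: "h \<in> borel_measurable N" by (rule measurable_FB_N[OF hT T_in])
    note [measurable] = hN pm dens_measurable_N[OF q[OF i]] dens_measurable_N[OF T_in]
    have hint: "integrable N (\<lambda>x. dens T x * h x)"
    proof (rule dominated_integrable[OF hT])
      show "AE x in N. \<bar>h x\<bar> \<le> dom (fst x)"
        using AE_N_pay_le_dom
      proof eventually_elim
        case (elim x)
        then have "\<bar>pay (?q i) (fst x)\<bar> \<le> dom (fst x)" using q[OF i] by blast
        then show ?case by (auto simp: h_def indicator_def)
      qed
    qed
    have e: "AE x in N. dens s x * p i x = dens s x * h x" for s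
      using ph by eventually_elim simp
    show ?thesis
    proof (intro conjI)
      show "integrable N (\<lambda>x. dens (?q i) x * p i x)"
        using hint dens_change(1)[OF q[OF i] hm]
        by (subst integrable_cong_AE[OF _ _ e]) auto
      show "integrable N (\<lambda>x. dens T x * p i x)"
        using hint by (subst integrable_cong_AE[OF _ _ e]) auto
      have "(\<integral>x. dens (?q i) x * p i x \<partial>N) = (\<integral>x. dens (?q i) x * h x \<partial>N)"
        by (rule integral_cong_AE[OF _ _ e]) measurable
      also have "\<dots> = (\<integral>x. dens T x * h x \<partial>N)" by (rule dens_change(2)[OF q[OF i] hm])
      also have "\<dots> = (\<integral>x. dens T x * p i x \<partial>N)"
        by (rule integral_cong_AE[OF _ _ e, symmetric]) measurable
      finally show "(\<integral>x. dens (?q i) x * p i x \<partial>N) = (\<integral>x. dens T x * p i x \<partial>N)" .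
    qed
  qed
  have "(\<integral>x. indicator A x * stop_dens (\<lambda>x. grid_ceil t T n (\<sigma> x)) x \<partial>N)
      = (\<integral>x. (\<Sum>i\<le>Suc n. dens (?q i) x * p i x) \<partial>N)"
    by (rule Bochner_Integration.integral_cong[OF refl])
       (simp only: grid_stop_eq[OF \<sigma>] sum_distrib_left, intro sum.cong refl, simp add: p_def mult_ac)
  also have "\<dots> = (\<Sum>i\<le>Suc n. \<integral>x. dens (?q i) x * p i x \<partial>N)"
    using cell by (intro Bochner_Integration.integral_sum) auto
  also have "\<dots> = (\<Sum>i\<le>Suc n. \<integral>x. dens T x * p i x \<partial>N)"
    using cell by (intro sum.cong) auto
  also have "\<dots> = (\<integral>x. (\<Sum>i\<le>Suc n. dens T x * p i x) \<partial>N)"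
    using cell by (intro Bochner_Integration.integral_sum[symmetric]) auto
  also have "\<dots> = (\<integral>x. dens T x * (indicator A x * stop_pay (\<lambda>x. grid_ceil t T n (\<sigma> x)) x) \<partial>N)"
    by (rule Bochner_Integration.integral_cong[OF refl])
       (simp only: grid_stop_eq[OF \<sigma>] sum_distrib_left, intro sum.cong refl, simp add: p_def mult_ac)
  finally show ?thesis .
qed

text \<open>Both sides of the grid identity converge, for different reasons: with the density fixed
  at \<open>T\<close> the integrands are dominated by \<open>H\<close>, whereas on the other side
  the density varies with the grid and convergence rests on the excess bound.\<close>

lemma
  assumes t: "t \<in> {0..T}" and \<sigma>: "\<sigma> \<in> raw_times t"
  shows stop_dens_integrable: "integrable N (stop_dens \<sigma>)"
    and stop_pay_integrable: "integrable N (\<lambda>x. dens T x * stop_pay \<sigma> x)"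
    and optional_stopping: "A \<in> sets (FB t) \<Longrightarrow>
      (LINT x:A|N. stop_dens \<sigma> x) = (LINT x:A|N. dens T x * stop_pay \<sigma> x)"
proof -
  let ?c = "\<lambda>n x. grid_ceil t T n (\<sigma> x)"
  note sd[measurable] = measurable_FB_N[OF stop_measurable(2)[OF t \<sigma>] T_in]
  note sp[measurable] = measurable_FB_N[OF stop_measurable(1)[OF t \<sigma>] T_in]
  note gd[measurable] = measurable_FB_N[OF grid_stop_measurable(2)[OF t \<sigma>] T_in]
  note gp[measurable] = measurable_FB_N[OF grid_stop_measurable(1)[OF t \<sigma>] T_in]
  note dT[measurable] = dens_measurable_N[OF T_in]
  have fin: "finite_measure N" by unfold_locales
  have crange: "?c n x \<in> {t..T}" if "x \<in> space N" for n x
    by (rule grid_ceil_range[OF raw_times_range[OF \<sigma> that]])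
  have le: "AE x in N. \<bar>stop_pay (?c n) x\<bar> \<le> dom (fst x)" for n
    by (rule stop_pay_le_dom[OF t crange])
  show "integrable N (stop_dens \<sigma>)"
    using stop_grid_limit(2)[OF t \<sigma>]
    by (intro uniformly_integrable_limit(1)[OF fin gd sd _ H_integrable grid_excess[OF t \<sigma>]] AE_I2)
  show "integrable N (\<lambda>x. dens T x * stop_pay \<sigma> x)"
    using stop_pay_le_dom[OF t raw_times_range[OF \<sigma>]]
    by (intro dominated_integrable stop_measurable(1)[OF t \<sigma>])
  assume A: "A \<in> sets (FB t)"
  then have AN[measurable]: "A \<in> sets N" using subalgebra_FB[OF t] by (auto simp: subalgebra_def)
  have "(\<lambda>n. \<integral>x. indicator A x * stop_dens (?c n) x \<partial>N) \<longlonglongrightarrow> (\<integral>x. indicator A x * stop_dens \<sigma> x \<partial>N)"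
  proof (rule uniformly_integrable_limit(2)[OF fin _ _ _ H_integrable])
    show "AE x in N. (\<lambda>n. indicator A x * stop_dens (?c n) x) \<longlonglongrightarrow> indicator A x * stop_dens \<sigma> x"
      using stop_grid_limit(2)[OF t \<sigma>] by (intro AE_I2 tendsto_mult tendsto_const)
    fix n and K :: real assume K: "0 \<le> K"
    have "(\<integral>\<^sup>+x. ennreal (\<bar>indicator A x * stop_dens (?c n) x\<bar> - K) \<partial>N)
        \<le> (\<integral>\<^sup>+x. ennreal (\<bar>stop_dens (?c n) x\<bar> - K) \<partial>N)"
      by (intro nn_integral_mono ennreal_leI) (auto simp: indicator_def)
    then show "(\<integral>\<^sup>+x. ennreal (\<bar>indicator A x * stop_dens (?c n) x\<bar> - K) \<partial>N) \<le> (\<integral>\<^sup>+x. ennreal (H x - K) \<partial>N)"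
      using grid_excess[OF t \<sigma> K] by (rule order_trans)
  qed measurable
  moreover have "(\<lambda>n. \<integral>x. indicator A x * stop_dens (?c n) x \<partial>N)
      \<longlonglongrightarrow> (\<integral>x. dens T x * (indicator A x * stop_pay \<sigma> x) \<partial>N)"
    unfolding grid_optional_stopping[OF t \<sigma> A]
  proof (rule integral_dominated_convergence[OF _ _ H_integrable])
    show "AE x in N. (\<lambda>n. dens T x * (indicator A x * stop_pay (?c n) x))
        \<longlonglongrightarrow> dens T x * (indicator A x * stop_pay \<sigma> x)"
      using stop_grid_limit(1)[OF t \<sigma>] by (intro AE_I2 tendsto_mult tendsto_const)
    show "AE x in N. norm (dens T x * (indicator A x * stop_pay (?c n) x)) \<le> H x" for n
      using le[of n] dens_pos_AE[OF T_in]
    proof eventually_elim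
      case (elim x)
      have "\<bar>indicator A x * stop_pay (?c n) x\<bar> \<le> dom (fst x)"
        using elim(1) by (auto simp: indicator_def)
      then show ?case using elim(2) by (simp add: H_def abs_mult[of "dens T x"])
    qed
  qed measurable
  ultimately show "(LINT x:A|N. stop_dens \<sigma> x) = (LINT x:A|N. dens T x * stop_pay \<sigma> x)"
    unfolding set_lebesgue_integral_def
    by (simp add: LIMSEQ_unique mult_ac)
qed


section \<open>Bayes' formula and essential suprema\<close>

abbreviation value_at :: "real \<Rightarrow> ('a \<times> real \<Rightarrow> real) \<Rightarrow> 'a \<times> real \<Rightarrow> real" where
  "value_at t \<sigma> \<equiv> real_cond_exp N (FB t) (stop_dens \<sigma>)"

abbreviation value_bound :: "real \<Rightarrow> 'a \<times> real \<Rightarrow> real" where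
  "value_bound t \<equiv> real_cond_exp N (FB t) H"

text \<open>By optional stopping the value is also the conditional expectation of the payoff
  weighted with the density at \<open>T\<close>, which is at most \<open>H\<close>. This common
  bound makes the essential supremum real-valued.\<close>

lemma value_at_le_bound:
  assumes t: "t \<in> {0..T}" and \<sigma>: "\<sigma> \<in> raw_times t"
  shows "AE x in N. value_at t \<sigma> x \<le> value_bound t x"
proof -
  interpret S: sigma_finite_subalgebra N "FB t" by (rule sigma_finite_subalgebra_FB[OF t])
  have "AE x in N. real_cond_exp N (FB t) (\<lambda>x. dens T x * stop_pay \<sigma> x) x = value_at t \<sigma> x"
  proof (rule S.real_cond_exp_charact)
    show "(LINT x:A|N. dens T x * stop_pay \<sigma> x) = (LINT x:A|N. value_at t \<sigma> x)"
      if "A \<in> sets (FB t)" for A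
      using optional_stopping[OF t \<sigma> that] S.real_cond_exp_intA[OF stop_dens_integrable[OF t \<sigma>] that] by simp
  qed (use stop_pay_integrable[OF t \<sigma>] S.real_cond_exp_int(1)[OF stop_dens_integrable[OF t \<sigma>]] in auto)
  moreover have "AE x in N. real_cond_exp N (FB t) (\<lambda>x. dens T x * stop_pay \<sigma> x) x \<le> value_bound t x"
  proof (rule S.real_cond_exp_mono[OF _ stop_pay_integrable[OF t \<sigma>] H_integrable])
    have "AE x in N. \<bar>stop_pay \<sigma> x\<bar> \<le> dom (fst x)"
      by (rule stop_pay_le_dom[OF t raw_times_range[OF \<sigma>]])
    then show "AE x in N. dens T x * stop_pay \<sigma> x \<le> H x"
      using dens_pos_AE[OF T_in]
      by eventually_elim (auto simp: H_def intro!: mult_left_mono)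
  qed
  ultimately show ?thesis by eventually_elim simp
qed

text \<open>Test sets in \<open>PF t\<close> may be replaced by their \<open>FB t\<close> versions,
  so neither completion nor the look at later times alters the conditional expectation.
  Measurability of \<open>f\<close>, known only up to a null set, comes from completeness of
  \<open>Phat\<close>.\<close>

lemma prod_value_eq:
  assumes t: "t \<in> {0..T}" and \<sigma>: "\<sigma> \<in> raw_times t" and ae: "AE x in N. f x = stop_dens \<sigma> x"
  shows "AE x in N. real_cond_exp Phat (PF t) f x = value_at t \<sigma> x"
proof -
  interpret S: sigma_finite_subalgebra N "FB t" by (rule sigma_finite_subalgebra_FB[OF t])
  interpret Ph: prob_space Phat
    unfolding prod_space_def by (rule Mlaw.P.prob_space_completion)
  interpret Ph: finite_measure_subalgebra Phat "PF t"
    by unfold_locales (rule subalgebra_PF[OF t])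
  interpret Ph: sigma_finite_subalgebra Phat "PF t"
    by (rule finite_measure_subalgebra_is_sigma_finite) unfold_locales
  have sN: "stop_dens \<sigma> \<in> borel_measurable N" by (rule measurable_FB_N[OF stop_measurable(2)[OF t \<sigma>] T_in])
  then have sP: "stop_dens \<sigma> \<in> borel_measurable Phat" unfolding prod_space_def by (rule measurable_completion)
  have fP: "f \<in> borel_measurable Phat"
    using sP unfolding prod_space_def
    by (rule completion.borel_measurable_AE_eq) (use ae in \<open>auto simp: AE_completion_iff elim: eventually_mono\<close>)
  let ?X = "value_at t \<sigma>"
  have XN: "?X \<in> borel_measurable N" by (rule measurable_FB_N[OF borel_measurable_cond_exp t])
  have LPN: "(LINT x:A|Phat. g x) = (LINT x:B|N. g x)"
    if "A \<in> sets (PF t)" "B \<in> sets (FB t)" "AE x in N. x \<in> A \<longleftrightarrow> x \<in> B" "g \<in> borel_measurable N" for A B and g :: "_ \<Rightarrow> real"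
  proof -
    have A: "A \<in> sets Phat" and B: "B \<in> sets N"
      using subalgebra_PF[OF t] subalgebra_FB[OF t] that(1,2) by (auto simp: subalgebra_def)
    have BP: "B \<in> sets Phat" using B unfolding prod_space_def by simp
    have gP: "g \<in> borel_measurable Phat" using that(4) unfolding prod_space_def by (rule measurable_completion)
    have "(LINT x:A|Phat. g x) = (LINT x:B|Phat. g x)"
      unfolding set_lebesgue_integral_def
    proof (rule integral_cong_AE)
      show "AE x in Phat. indicator A x *\<^sub>R g x = indicator B x *\<^sub>R g x"
        unfolding AE_Phat_iff using that(3) by eventually_elim (simp add: indicator_def)
    qed (use A BP gP in auto)
    also have "\<dots> = (LINT x:B|N. g x)"
      unfolding set_lebesgue_integral_def prod_space_def
      by (rule integral_completion) (use B that(4) in auto)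
    finally show ?thesis .
  qed
  have "AE x in Phat. real_cond_exp Phat (PF t) (stop_dens \<sigma>) x = ?X x"
  proof (rule Ph.real_cond_exp_charact)
    fix A assume A: "A \<in> sets (PF t)"
    then obtain B where B: "B \<in> sets (FB t)" "AE x in N. x \<in> A \<longleftrightarrow> x \<in> B"
      unfolding sets_PF_iff[OF t] by blast
    show "(LINT x:A|Phat. stop_dens \<sigma> x) = (LINT x:A|Phat. ?X x)"
      unfolding LPN[OF A B sN] LPN[OF A B XN]
      by (rule S.real_cond_exp_intA[OF stop_dens_integrable[OF t \<sigma>] B(1)])
  next
    show "integrable Phat (stop_dens \<sigma>)"
      using stop_dens_integrable[OF t \<sigma>] sN unfolding prod_space_def by (simp add: integrable_completion)
    show "integrable Phat ?X"
      using S.real_cond_exp_int(1)[OF stop_dens_integrable[OF t \<sigma>]] XN unfolding prod_space_def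
      by (simp add: integrable_completion)
    show "?X \<in> borel_measurable (PF t)"
      by (rule measurable_from_subalg[OF subalgebra_PF_FB[OF t] borel_measurable_cond_exp])
  qed
  moreover have "AE x in Phat. real_cond_exp Phat (PF t) f x = real_cond_exp Phat (PF t) (stop_dens \<sigma>) x"
    by (rule Ph.real_cond_exp_cong[OF _ fP sP]) (use ae in \<open>simp add: AE_Phat_iff\<close>)
  ultimately have "AE x in Phat. real_cond_exp Phat (PF t) f x = ?X x" by eventually_elim simp
  then show ?thesis by (simp only: AE_Phat_iff)
qed

text \<open>
  Bayes' formula: \<open>dens t\<close> is the density on \<open>FB t\<close> of the law of \<open>graph\<close>, and optional
  stopping replaces the density at the stopping time by the one at \<open>T\<close>.
\<close>

lemma enlarged_value_eq:
  assumes t: "t \<in> {0..T}" and \<sigma>: "\<sigma> \<in> raw_times t"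
    and f: "\<And>\<omega>. \<omega> \<in> space M \<Longrightarrow> f \<omega> = stop_pay \<sigma> (graph \<omega>)"
  shows "AE \<omega> in M. real_cond_exp M (GF t) f \<omega> = value_at t \<sigma> (graph \<omega>) / dens t (graph \<omega>)"
proof -
  interpret S: sigma_finite_subalgebra N "FB t" by (rule sigma_finite_subalgebra_FB[OF t])
  interpret E: finite_measure_subalgebra M "GF t"
    by unfold_locales (rule subalgebra_GF[OF t])
  interpret E: sigma_finite_subalgebra M "GF t"
    by (rule finite_measure_subalgebra_is_sigma_finite) unfold_locales
  let ?X = "value_at t \<sigma>"
  obtain d where d[measurable]: "d \<in> borel_measurable (FB t)" and deq: "AE x in N. d x = dens t x"
    using dens_version[OF t] by blast
  \<comment> \<open>Division by the \<open>FB t\<close> version \<open>d\<close> keeps the candidate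
    measurable for \<open>GF t\<close> along the graph; \<open>dens t\<close> is restored at the
    end.\<close>
  define g where "g x = ?X x / d x" for x
  have gm[measurable]: "g \<in> borel_measurable (FB t)" unfolding g_def[abs_def] by measurable
  have sp: "stop_pay \<sigma> \<in> borel_measurable (FB T)" by (rule stop_measurable(1)[OF t \<sigma>])
  have XN: "?X \<in> borel_measurable N" by (rule measurable_FB_N[OF borel_measurable_cond_exp t])
  have gN: "g \<in> borel_measurable N" by (rule measurable_FB_N[OF gm t])
  note [measurable] = XN gN dens_measurable_N[OF t]
  have dg: "AE x in N. dens t x * g x = ?X x"
    using deq dens_pos_AE[OF t] by eventually_elim (simp add: g_def)
  have Xint: "integrable N ?X" by (rule S.real_cond_exp_int(1)[OF stop_dens_integrable[OF t \<sigma>]])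
  have fm: "integrable M (\<lambda>\<omega>. stop_pay \<sigma> (graph \<omega>))"
    using integrable_graph_iff[OF T_in sp] stop_pay_integrable[OF t \<sigma>] by simp
  then have fint: "integrable M f"
    by (subst Bochner_Integration.integrable_cong[OF refl f])
  have "AE \<omega> in M. real_cond_exp M (GF t) f \<omega> = g (graph \<omega>)"
  proof (rule E.real_cond_exp_charact[OF _ fint])
    have "integrable N (\<lambda>x. dens t x * g x)"
      using Xint by (subst integrable_cong_AE[OF _ _ dg]) auto
    then show "integrable M (\<lambda>\<omega>. g (graph \<omega>))" using integrable_graph_iff[OF t gm] by simp
    show "(\<lambda>\<omega>. g (graph \<omega>)) \<in> borel_measurable (GF t)"
      by (rule measurable_compose[OF graph_GF_measurable[OF t] gm])
    fix A assume "A \<in> sets (GF t)"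
    then obtain B where B[measurable]: "B \<in> sets (FB t)" and A: "A = {\<omega> \<in> space M. graph \<omega> \<in> B}"
      unfolding sets_GF_iff[OF t] by blast
    have BT[measurable]: "B \<in> sets (FB T)" using B sets_FB_mono[of t T] t by auto
    have BN[measurable]: "B \<in> sets N" using B subalgebra_FB[OF t] by (auto simp: subalgebra_def)
    have "(LINT \<omega>:A|M. f \<omega>) = (\<integral>\<omega>. indicator B (graph \<omega>) * stop_pay \<sigma> (graph \<omega>) \<partial>M)"
      unfolding set_lebesgue_integral_def
      by (rule Bochner_Integration.integral_cong) (auto simp: A f indicator_def)
    \<comment> \<open>The change of variables is made at \<open>T\<close>, because the stopped
      payoff is only known to be \<open>FB T\<close>-measurable.\<close>
    also have "\<dots> = (\<integral>x. dens T x * (indicator B x * stop_pay \<sigma> x) \<partial>N)"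
      by (rule integral_graph[OF T_in]) (intro borel_measurable_times borel_measurable_indicator BT sp)
    also have "\<dots> = (LINT x:B|N. dens T x * stop_pay \<sigma> x)"
      by (simp add: set_lebesgue_integral_def mult_ac)
    also have "\<dots> = (LINT x:B|N. ?X x)"
      using optional_stopping[OF t \<sigma> B] S.real_cond_exp_intA[OF stop_dens_integrable[OF t \<sigma>] B] by simp
    also have "\<dots> = (\<integral>x. dens t x * (indicator B x * g x) \<partial>N)"
      unfolding set_lebesgue_integral_def
    proof (rule integral_cong_AE)
      show "AE x in N. indicator B x *\<^sub>R ?X x = dens t x * (indicator B x * g x)"
        using dg by eventually_elim (simp add: indicator_def)
    qed measurable
    \<comment> \<open>The way back uses the density at \<open>t\<close>, the integrand now being
      \<open>FB t\<close>-measurable.\<close>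
    also have "\<dots> = (\<integral>\<omega>. indicator B (graph \<omega>) * g (graph \<omega>) \<partial>M)"
      by (rule integral_graph[OF t, symmetric]) measurable
    also have "\<dots> = (LINT \<omega>:A|M. g (graph \<omega>))"
      unfolding set_lebesgue_integral_def
      by (rule Bochner_Integration.integral_cong) (auto simp: A indicator_def)
    finally show "(LINT \<omega>:A|M. f \<omega>) = (LINT \<omega>:A|M. g (graph \<omega>))" .
  qed
  moreover have "AE \<omega> in M. g (graph \<omega>) = ?X (graph \<omega>) / dens t (graph \<omega>)"
  proof (rule AE_graph_eq_iff[THEN iffD2])
    show "g \<in> borel_measurable (FB T)" using measurable_FB_mono[OF gm] t by simp
    have "?X \<in> borel_measurable (FB T)" using measurable_FB_mono[OF borel_measurable_cond_exp] t by simp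
    then show "(\<lambda>x. ?X x / dens t x) \<in> borel_measurable (FB T)"
      using dens_measurable[OF t] by (rule borel_measurable_divide)
    show "AE x in N. g x = ?X x / dens t x" using deq by eventually_elim (simp add: g_def)
  qed
  ultimately show ?thesis by eventually_elim simp
qed

section \<open>Matching the two value families and their suprema\<close>

lemma const_raw_time:
  assumes "t \<in> {0..T}" shows "(\<lambda>_. T) \<in> raw_times t"
  unfolding raw_times_def
proof (intro CollectI conjI ballI)
  fix s assume s: "s \<in> {0..T}"
  show "{x \<in> space N. T \<le> s} \<in> sets (PF s)"
  proof (cases "T \<le> s")
    case True
    then show ?thesis using sets.top[of "PF s"] unfolding space_PF[OF s] by simp
  next
    case False
    then have "{x \<in> space N. T \<le> s} = {}" by simp
    then show ?thesis by (simp only: sets.empty_sets)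
  qed
qed (use assms in auto)

text \<open>Modifying a time on a null set changes the stopped payoff only on that set, so raw times
  produce the whole family up to null sets.\<close>

lemma prod_values_eq:
  assumes t: "t \<in> {0..T}"
  shows "X \<in> prod_values M F T G L \<xi> \<alpha> t \<Longrightarrow> \<exists>\<sigma>\<in>raw_times t. AE x in Phat. X x = value_at t \<sigma> x"
    and "\<sigma> \<in> raw_times t \<Longrightarrow> \<exists>X\<in>prod_values M F T G L \<xi> \<alpha> t. AE x in Phat. X x = value_at t \<sigma> x"
proof -
  let ?f = "\<lambda>\<tau> (\<omega>, u). prod_payoff T L \<xi> \<alpha> u (\<tau> (\<omega>, u)) \<omega>"
  have eq: "AE x in Phat. real_cond_exp Phat (PF t) (?f \<tau>) x = value_at t \<sigma> x"
    if \<sigma>: "\<sigma> \<in> raw_times t" and ae: "AE x in N. \<tau> x = \<sigma> x" for \<tau> \<sigma>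
    unfolding AE_Phat_iff
  proof (rule prod_value_eq[OF t \<sigma>])
    show "AE x in N. ?f \<tau> x = stop_dens \<sigma> x"
      using ae AE_space
    proof eventually_elim
      case (elim x)
      have "\<sigma> x \<in> {0..T}" using raw_times_range[OF \<sigma> elim(2)] t by auto
      then show ?case using prod_payoff_eq[of \<sigma> x] elim(1) by (simp add: split_beta)
    qed
  qed
  show "\<exists>\<sigma>\<in>raw_times t. AE x in Phat. X x = value_at t \<sigma> x" if X: "X \<in> prod_values M F T G L \<xi> \<alpha> t"
  proof -
    obtain \<tau> where \<tau>: "\<tau> \<in> stopping_times (space Phat) PF T t" and Xeq: "X = real_cond_exp Phat (PF t) (?f \<tau>)"
      using X unfolding prod_values_def by blast
    obtain \<sigma> where \<sigma>: "\<sigma> \<in> raw_times t" and ae: "AE x in N. \<tau> x = \<sigma> x"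
      using stopping_time_raw_version[OF t \<tau>] by blast
    show ?thesis using eq[OF \<sigma> ae] \<sigma> unfolding Xeq by (rule bexI)
  qed
  show "\<exists>X\<in>prod_values M F T G L \<xi> \<alpha> t. AE x in Phat. X x = value_at t \<sigma> x" if \<sigma>: "\<sigma> \<in> raw_times t"
  proof (rule bexI)
    show "AE x in Phat. real_cond_exp Phat (PF t) (?f \<sigma>) x = value_at t \<sigma> x" by (rule eq[OF \<sigma>]) simp
    show "real_cond_exp Phat (PF t) (?f \<sigma>) \<in> prod_values M F T G L \<xi> \<alpha> t"
      unfolding prod_values_def using raw_times_stopping[OF t \<sigma>] by blast
  qed
qed

text \<open>The times of the enlarged filtration are the raw times composed with
  \<open>graph\<close>; both value families are thereby indexed by
  \<open>raw_times t\<close>.\<close>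

lemma enlarged_values_eq:
  assumes t: "t \<in> {0..T}"
  shows "V \<in> enlarged_values M F T G L \<xi> t \<Longrightarrow>
      \<exists>\<sigma>\<in>raw_times t. AE \<omega> in M. V \<omega> = value_at t \<sigma> (graph \<omega>) / dens t (graph \<omega>)"
    and "\<sigma> \<in> raw_times t \<Longrightarrow>
      \<exists>V\<in>enlarged_values M F T G L \<xi> t. AE \<omega> in M. V \<omega> = value_at t \<sigma> (graph \<omega>) / dens t (graph \<omega>)"
proof -
  have gr: "stop_pay \<sigma> (graph \<omega>) = pay (\<sigma> (graph \<omega>)) \<omega>" for \<sigma> \<omega>
    by (simp add: stop_pay_def graph_def)
  show "\<exists>\<sigma>\<in>raw_times t. AE \<omega> in M. V \<omega> = value_at t \<sigma> (graph \<omega>) / dens t (graph \<omega>)"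
    if V: "V \<in> enlarged_values M F T G L \<xi> t"
  proof -
    obtain \<tau> where \<tau>: "\<tau> \<in> stopping_times (space M) (enlarged M F G) T t"
      and Veq: "V = real_cond_exp M (GF t) (\<lambda>\<omega>. pay (\<tau> \<omega>) \<omega>)"
      using V unfolding enlarged_values_def by blast
    obtain \<sigma> where \<sigma>: "\<sigma> \<in> raw_times t" and eq: "\<forall>\<omega>\<in>space M. \<tau> \<omega> = \<sigma> (graph \<omega>)"
      using enlarged_time_factor[OF t \<tau>] by blast
    have "AE \<omega> in M. V \<omega> = value_at t \<sigma> (graph \<omega>) / dens t (graph \<omega>)"
      unfolding Veq by (rule enlarged_value_eq[OF t \<sigma>]) (simp add: eq gr)
    then show ?thesis using \<sigma> by (rule bexI)
  qed
  show "\<exists>V\<in>enlarged_values M F T G L \<xi> t. AE \<omega> in M. V \<omega> = value_at t \<sigma> (graph \<omega>) / dens t (graph \<omega>)"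
    if \<sigma>: "\<sigma> \<in> raw_times t"
  proof (rule bexI)
    show "AE \<omega> in M. real_cond_exp M (GF t) (\<lambda>\<omega>. pay (\<sigma> (graph \<omega>)) \<omega>) \<omega> = value_at t \<sigma> (graph \<omega>) / dens t (graph \<omega>)"
      by (rule enlarged_value_eq[OF t \<sigma>]) (simp add: gr)
    show "real_cond_exp M (GF t) (\<lambda>\<omega>. pay (\<sigma> (graph \<omega>)) \<omega>) \<in> enlarged_values M F T G L \<xi> t"
      unfolding enlarged_values_def
      by (intro CollectI exI[of _ "\<lambda>\<omega>. \<sigma> (graph \<omega>)"] conjI refl raw_times_graph[OF t \<sigma>])
  qed
qed

text \<open>The upper bound property passes through the graph because it compares
  \<open>FB T\<close>-measurable functions. A competitor \<open>Z\<close> for minimality is only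
  \<open>M\<close>-measurable, so minimality is checked against the sequence \<open>X\<close>, whose
  capped supremum is \<open>Y\<close> at every point and not just almost everywhere.\<close>

lemma ess_sup_transfer:
  assumes t: "t \<in> {0..T}"
  shows "\<exists>Y\<in>borel_measurable (FB t). is_ess_sup Phat (prod_values M F T G L \<xi> \<alpha> t) Y \<and>
    is_ess_sup M (enlarged_values M F T G L \<xi> t) (\<lambda>\<omega>. Y (graph \<omega>) / dens t (graph \<omega>))"
proof -
  let ?\<Phi> = "value_at t ` raw_times t" and ?b = "value_bound t"
  interpret Ph: prob_space Phat
    unfolding prod_space_def by (rule Mlaw.P.prob_space_completion)
  have sub: "subalgebra Phat (FB t)"
    using subalgebra_FB[OF t] unfolding prod_space_def by (auto simp: subalgebra_def)
  have toT: "f \<in> borel_measurable (FB T)" if "f \<in> borel_measurable (FB t)" for f :: "'a \<times> real \<Rightarrow> real"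
    using measurable_FB_mono[OF that] t by simp
  have "\<exists>X::nat \<Rightarrow> 'a \<times> real \<Rightarrow> real. range X \<subseteq> ?\<Phi> \<and>
      (\<lambda>x. SUP n. min (X n x) (?b x)) \<in> borel_measurable (FB t) \<and>
      is_ess_sup Phat ?\<Phi> (\<lambda>x. SUP n. min (X n x) (?b x))"
  proof (rule ess_sup_countable[OF Ph.finite_measure_axioms sub])
    show "?\<Phi> \<noteq> {}" using const_raw_time[OF t] by blast
    show "?\<Phi> \<subseteq> borel_measurable (FB t)" by auto
    show "AE x in Phat. X x \<le> ?b x" if "X \<in> ?\<Phi>" for X
      unfolding AE_Phat_iff using that value_at_le_bound[OF t] by auto
  qed auto
  then obtain X :: "nat \<Rightarrow> 'a \<times> real \<Rightarrow> real" where X: "range X \<subseteq> ?\<Phi>"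
    and Ym: "(\<lambda>x. SUP n. min (X n x) (?b x)) \<in> borel_measurable (FB t)"
    and Ysup: "is_ess_sup Phat ?\<Phi> (\<lambda>x. SUP n. min (X n x) (?b x))"
    by (elim exE conjE)
  define Y where "Y x = (SUP n. min (X n x) (?b x))" for x
  have Ym': "Y \<in> borel_measurable (FB t)" using Ym by (simp add: Y_def[abs_def])
  have Yle: "AE x in N. value_at t \<sigma> x \<le> Y x" if "\<sigma> \<in> raw_times t" for \<sigma>
    using Ysup that unfolding is_ess_sup_def AE_Phat_iff Y_def by blast
  have "is_ess_sup Phat (prod_values M F T G L \<xi> \<alpha> t) Y"
  proof (rule is_ess_sup_cong_family)
    show "is_ess_sup Phat ?\<Phi> Y" using Ysup by (simp add: Y_def[abs_def])
    fix Z assume "Z \<in> ?\<Phi>"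
    then obtain \<sigma> where \<sigma>: "\<sigma> \<in> raw_times t" "Z = value_at t \<sigma>" by blast
    obtain X where "X \<in> prod_values M F T G L \<xi> \<alpha> t" "AE x in Phat. X x = value_at t \<sigma> x"
      using prod_values_eq(2)[OF t \<sigma>(1)] by blast
    then show "\<exists>X\<in>prod_values M F T G L \<xi> \<alpha> t. AE x in Phat. Z x = X x"
      unfolding \<sigma>(2) by (intro bexI[of _ X]) (auto elim: eventually_mono)
  next
    fix X assume "X \<in> prod_values M F T G L \<xi> \<alpha> t"
    then obtain \<sigma> where "\<sigma> \<in> raw_times t" "AE x in Phat. X x = value_at t \<sigma> x"
      using prod_values_eq(1)[OF t] by blast
    then show "\<exists>Z\<in>?\<Phi>. AE x in Phat. Z x = X x"
      by (intro bexI[of _ "value_at t \<sigma>"]) (auto elim: eventually_mono)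
  qed
  moreover have "is_ess_sup M (enlarged_values M F T G L \<xi> t) (\<lambda>\<omega>. Y (graph \<omega>) / dens t (graph \<omega>))"
    unfolding is_ess_sup_def
  proof (intro conjI ballI impI)
    show "(\<lambda>\<omega>. Y (graph \<omega>) / dens t (graph \<omega>)) \<in> borel_measurable M"
      by (intro borel_measurable_divide graph_compose_measurable[OF toT[OF Ym'] T_in]
          graph_compose_measurable[OF dens_measurable[OF t] T_in])
  next
    fix V assume "V \<in> enlarged_values M F T G L \<xi> t"
    then obtain \<sigma> where \<sigma>: "\<sigma> \<in> raw_times t"
      and V: "AE \<omega> in M. V \<omega> = value_at t \<sigma> (graph \<omega>) / dens t (graph \<omega>)"
      using enlarged_values_eq(1)[OF t] by blast
    note [measurable] = toT[OF Ym'] toT[OF borel_measurable_cond_exp[of N "FB t" "stop_dens \<sigma>"]]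
    have "{x \<in> space (FB T). value_at t \<sigma> x \<le> Y x} \<in> sets (FB T)" by measurable
    then have "{x \<in> space N. value_at t \<sigma> x \<le> Y x} \<in> sets (FB T)"
      by (simp add: space_FB space_N)
    then have "AE \<omega> in M. value_at t \<sigma> (graph \<omega>) \<le> Y (graph \<omega>)"
      by (rule AE_graph_iff[THEN iffD2, OF _ Yle[OF \<sigma>]])
    with V show "AE \<omega> in M. V \<omega> \<le> Y (graph \<omega>) / dens t (graph \<omega>)"
      using AE_space
    proof eventually_elim
      case (elim \<omega>)
      then show ?case using dens_pos[OF t graph_space[OF elim(3)]] by (simp add: divide_right_mono)
    qed
  next
    fix Z assume Z: "\<forall>V\<in>enlarged_values M F T G L \<xi> t. AE \<omega> in M. V \<omega> \<le> Z \<omega>"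
    have "AE \<omega> in M. X n (graph \<omega>) / dens t (graph \<omega>) \<le> Z \<omega>" for n
    proof -
      obtain \<sigma> where \<sigma>: "\<sigma> \<in> raw_times t" "X n = value_at t \<sigma>" using X by blast
      obtain V where V: "V \<in> enlarged_values M F T G L \<xi> t"
        and eq: "AE \<omega> in M. V \<omega> = value_at t \<sigma> (graph \<omega>) / dens t (graph \<omega>)"
        using enlarged_values_eq(2)[OF t \<sigma>(1)] by blast
      have "AE \<omega> in M. V \<omega> \<le> Z \<omega>" using Z V by blast
      with eq show ?thesis unfolding \<sigma>(2) by eventually_elim simp
    qed
    then have "AE \<omega> in M. \<forall>n. X n (graph \<omega>) / dens t (graph \<omega>) \<le> Z \<omega>"
      by (simp add: AE_all_countable)
    then show "AE \<omega> in M. Y (graph \<omega>) / dens t (graph \<omega>) \<le> Z \<omega>"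
      using AE_space
    proof eventually_elim
      case (elim \<omega>)
      have pos: "0 < dens t (graph \<omega>)" by (rule dens_pos[OF t graph_space[OF elim(2)]])
      \<comment> \<open>Clearing the positive denominator, which does not depend on
        \<open>n\<close>, turns the bounds on all \<open>X n\<close> into one bound on their capped
        supremum.\<close>
      have "X n (graph \<omega>) \<le> Z \<omega> * dens t (graph \<omega>)" for n
        using elim(1) pos by (simp add: pos_divide_le_eq)
      then have "Y (graph \<omega>) \<le> Z \<omega> * dens t (graph \<omega>)"
        unfolding Y_def by (intro cSUP_least) (auto intro: min.coboundedI1)
      then show ?case using pos by (simp add: pos_divide_le_eq)
    qed
  qed
  ultimately show ?thesis using Ym' by blast
qed

end

theorem theorem3p11:
  fixes M :: "'a measure" and F :: "real \<Rightarrow> 'a measure" and T :: real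
    and G :: "'a \<Rightarrow> real" and \<kappa> :: "real \<Rightarrow> 'a \<Rightarrow> real measure"
    and \<alpha> :: "real \<Rightarrow> real \<Rightarrow> 'a \<Rightarrow> real"
    and L :: "real \<Rightarrow> 'a \<Rightarrow> real" and \<xi> :: "'a \<Rightarrow> real" and t :: real
  assumes "filtered_prob_space M F T"
    and "G \<in> borel_measurable M"
    and "\<forall>s\<in>{0..T}. regular_cond_law M (F s) G (\<kappa> s)"
    and "density_hypothesis M T G \<kappa>"
    and "density_process M F T G \<kappa> \<alpha>"
    and "\<forall>s\<in>{0..T}. L s \<in> borel_measurable (F s)"
    and "\<forall>\<omega>\<in>space M. cadlag_on T (\<lambda>s. L s \<omega>)"
    and "\<xi> \<in> borel_measurable (F T)"
    and "AE \<omega> in M. 0 \<le> L T \<omega> \<and> L T \<omega> \<le> \<xi> \<omega>"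
    and "(\<integral>\<^sup>+ \<omega>. (SUP s\<in>{0..T}. ennreal \<bar>L s \<omega>\<bar>) + ennreal \<bar>\<xi> \<omega>\<bar> \<partial>M) < \<infinity>"
    and "t \<in> {0..T}"
  shows "(\<exists>V. is_ess_sup M (enlarged_values M F T G L \<xi> t) V) \<and>
    (\<exists>Y\<in>borel_measurable (raw_prod_filtration M F T t).
       is_ess_sup (prod_space M G) (prod_values M F T G L \<xi> \<alpha> t) Y) \<and>
    (\<forall>V Y. is_ess_sup M (enlarged_values M F T G L \<xi> t) V \<longrightarrow>
       Y \<in> borel_measurable (F T \<Otimes>\<^sub>M borel) \<longrightarrow>
       is_ess_sup (prod_space M G) (prod_values M F T G L \<xi> \<alpha> t) Y \<longrightarrow>
       (AE \<omega> in M. V \<omega> = 1 / \<alpha> t (G \<omega>) \<omega> * Y (\<omega>, G \<omega>)))"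
proof -
  interpret filtered_prob_space M F T by fact
  interpret optimal_stopping M F T G \<kappa> \<alpha> L \<xi>
    by unfold_locales (use assms(2-) in blast)+
  note t = \<open>t \<in> {0..T}\<close>
  obtain Y0 where Y0: "Y0 \<in> borel_measurable (FB t)"
    and prod: "is_ess_sup Phat (prod_values M F T G L \<xi> \<alpha> t) Y0"
    and enl: "is_ess_sup M (enlarged_values M F T G L \<xi> t) (\<lambda>\<omega>. Y0 (graph \<omega>) / dens t (graph \<omega>))"
    using ess_sup_transfer[OF t] by blast
  have "space (raw_prod_filtration M F T t) = space (FB t)"
    using prod_generator_closed[OF t] space_FB[OF t]
    unfolding raw_prod_filtration_def by (simp add: space_measure_of_conv)
  then have "Y0 \<in> borel_measurable (raw_prod_filtration M F T t)"
    using sets_FB_raw[OF t] by (intro measurable_from_subalg[OF _ Y0]) (simp add: subalgebra_def)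
  moreover have "AE \<omega> in M. V \<omega> = 1 / \<alpha> t (G \<omega>) \<omega> * Y (\<omega>, G \<omega>)"
    if V: "is_ess_sup M (enlarged_values M F T G L \<xi> t) V"
      and Y: "Y \<in> borel_measurable (F T \<Otimes>\<^sub>M borel)"
        "is_ess_sup (prod_space M G) (prod_values M F T G L \<xi> \<alpha> t) Y" for V Y
  proof -
    \<comment> \<open>Uniqueness of the essential supremum holds only up to product null sets; joint
      measurability of \<open>Y\<close> and \<open>Y0\<close> at \<open>T\<close> then carries the
      equality to the graph.\<close>
    have "AE x in N. Y x = Y0 x"
      using is_ess_sup_unique[OF Y(2) prod] by (simp only: AE_Phat_iff)
    then have "AE \<omega> in M. Y (graph \<omega>) = Y0 (graph \<omega>)"
      using measurable_FB_mono[OF Y0] t by (intro AE_graph_eq_iff[THEN iffD2] Y(1)) auto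
    with is_ess_sup_unique[OF V enl] show ?thesis
      by eventually_elim (simp add: graph_def dens_def)
  qed
  ultimately show ?thesis using prod enl by blast
qed

end
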